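(* Let $\alpha,\beta,\lambda$ be parameters and set $$g=729(\alpha+\beta)^3\lambda^{12}+(\beta-\alpha)^3,\qquad h=27\beta\left(27(\alpha+\beta)^2\lambda^9-9(\beta^2-\alpha^2)\lambda^6+(\beta-\alpha)^2\lambda^3\right),$$ $$t=\frac{(\alpha+\beta)g-(\beta+2\alpha)h}{2(h-g)},\qquad l=\frac{2\beta t+\beta(\alpha+\beta)}{h},\qquad k=\frac{ht^2+(2t+\alpha+\beta)\left(h(\alpha+\beta)-\beta(\beta-\alpha)^3\right)}{h},$$ $$u=(\beta-\alpha)-9(\alpha+\beta)\lambda^{3},\quad v=\beta-\alpha,\quad w=3(\beta-\alpha)\lambda-9(\alpha+\beta)\lambda^{4},\quad z=-9(\alpha+\beta)\lambda^{4}.$$ Then: (1) For all $\alpha,\beta,\lambda\in\mathbb{Q}$ with $h\neq 0$ and $h\neq g$, the four points $(z,t+\alpha)$, $(w,t+\beta)$, $(v,t+\alpha+\beta)$ and $(u,t)$ lie on the curve $$E_{\alpha,\beta,\lambda}:\quad y^{2}=lx^{3}+k.$$ (2) When $\alpha,\beta,\lambda$ are regarded as independent indeterminates over $\mathbb{Q}$, the elliptic curve $E_{\alpha,\beta,\lambda}$ over the field $\mathbb{Q}(\alpha,\beta,\lambda)$ has Mordell–Weil rank at least $4$. (3) For the choice $\alpha=2d$, $\beta=-d$ (with $d$ a nonzero rational parameter and $h\neq 0$, $h\neq g$), the ordinates of the four points in (1) form, after reordering, an arithmetic progression.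
   Context: The curve $y^2=lx^3+k$ (with $lk\neq 0$) is regarded as an elliptic curve with identity element its point at infinity; via $X=lx$, $Y=ly$ it is isomorphic to the Mordell curve $Y^2=X^3+l^2k$. The rank in (2) is the rank of the group of $\mathbb{Q}(\alpha,\beta,\lambda)$-rational points (the "generic rank" of the family). *)

theory Defs
  imports
    "HOL-Library.Multiset"
    "HOL-Library.Extended_Nat"
    "HOL-Computational_Algebra.Polynomial_Factorial"
    "HOL-Algebra.FiniteProduct"
begin

section \<open>The curves \<open>y\<^sup>2 = l x\<^sup>3 + k\<close> and their groups of points\<close>

definition affine_curve :: "'a::field \<Rightarrow> 'a \<Rightarrow> ('a \<times> 'a) set" where
  "affine_curve l k = {(x, y). y ^ 2 = l * x ^ 3 + k}"

definition nonsingular_curve :: "'a::field \<Rightarrow> 'a \<Rightarrow> bool" where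
  "nonsingular_curve l k \<longleftrightarrow> l * k \<noteq> 0"

datatype 'a ec_point = Infinity | Affine 'a 'a

definition ec_points :: "'a::field \<Rightarrow> 'a \<Rightarrow> 'a ec_point set" where
  "ec_points l k = insert Infinity ((\<lambda>(x, y). Affine x y) ` affine_curve l k)"

text \<open>
  Chord-and-tangent addition with neutral element \<open>Infinity\<close>, in characteristic other
  than 2 and 3. A line \<open>y = m x + c\<close> meets the curve in three points whose abscissas sum
  to \<open>m\<^sup>2 / l\<close>; the sum of two points is the reflection in the \<open>x\<close>-axis of the third
  intersection point. The tangent slope at \<open>(x, y)\<close> is \<open>3 l x\<^sup>2 / (2 y)\<close>.
\<close>

definition ec_third :: "'a::field \<Rightarrow> 'a \<Rightarrow> 'a \<Rightarrow> 'a \<Rightarrow> 'a \<Rightarrow> 'a ec_point" where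
  "ec_third l m x1 y1 x2 =
     (let x3 = m ^ 2 / l - x1 - x2 in Affine x3 (- (y1 + m * (x3 - x1))))"

fun ec_add :: "'a::field \<Rightarrow> 'a ec_point \<Rightarrow> 'a ec_point \<Rightarrow> 'a ec_point" where
  "ec_add l Infinity Q = Q"
| "ec_add l P Infinity = P"
| "ec_add l (Affine x1 y1) (Affine x2 y2) =
     (if x1 \<noteq> x2 then ec_third l ((y2 - y1) / (x2 - x1)) x1 y1 x2
      else if y1 = - y2 then Infinity
      else ec_third l (3 * l * x1 ^ 2 / (2 * y1)) x1 y1 x2)"

definition ec_group :: "'a::field \<Rightarrow> 'a \<Rightarrow> 'a ec_point monoid" where
  "ec_group l k = \<lparr>carrier = ec_points l k, mult = ec_add l, one = Infinity\<rparr>"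


section \<open>Rank of an abelian group\<close>

text \<open>
  The (torsion-free) rank is the supremum of the sizes of finite \<open>\<int>\<close>-linearly independent
  sets. The group is written multiplicatively, as in HOL-Algebra.
\<close>

definition int_independent :: "('a, 'b) monoid_scheme \<Rightarrow> 'a set \<Rightarrow> bool" where
  "int_independent G S \<longleftrightarrow>
     finite S \<and> S \<subseteq> carrier G \<and>
     (\<forall>n :: 'a \<Rightarrow> int. (\<Otimes>\<^bsub>G\<^esub>P\<in>S. P [^]\<^bsub>G\<^esub> n P) = \<one>\<^bsub>G\<^esub> \<longrightarrow> (\<forall>P\<in>S. n P = 0))"

definition abelian_rank :: "('a, 'b) monoid_scheme \<Rightarrow> enat" where
  "abelian_rank G = (SUP S\<in>{S. int_independent G S}. enat (card S))"

definition mordell_weil_rank :: "'a::field \<Rightarrow> 'a \<Rightarrow> enat" where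
  "mordell_weil_rank l k = abelian_rank (ec_group l k)"


section \<open>The family\<close>

definition fam_g :: "'a::field \<Rightarrow> 'a \<Rightarrow> 'a \<Rightarrow> 'a" where
  "fam_g \<alpha> \<beta> lam = 729 * (\<alpha> + \<beta>) ^ 3 * lam ^ 12 + (\<beta> - \<alpha>) ^ 3"

definition fam_h :: "'a::field \<Rightarrow> 'a \<Rightarrow> 'a \<Rightarrow> 'a" where
  "fam_h \<alpha> \<beta> lam =
     27 * \<beta> * (27 * (\<alpha> + \<beta>) ^ 2 * lam ^ 9 - 9 * (\<beta> ^ 2 - \<alpha> ^ 2) * lam ^ 6
               + (\<beta> - \<alpha>) ^ 2 * lam ^ 3)"

definition fam_t :: "'a::field \<Rightarrow> 'a \<Rightarrow> 'a \<Rightarrow> 'a" where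
  "fam_t \<alpha> \<beta> lam =
     (let g = fam_g \<alpha> \<beta> lam; h = fam_h \<alpha> \<beta> lam
      in ((\<alpha> + \<beta>) * g - (\<beta> + 2 * \<alpha>) * h) / (2 * (h - g)))"

definition fam_l :: "'a::field \<Rightarrow> 'a \<Rightarrow> 'a \<Rightarrow> 'a" where
  "fam_l \<alpha> \<beta> lam =
     (let h = fam_h \<alpha> \<beta> lam; t = fam_t \<alpha> \<beta> lam
      in (2 * \<beta> * t + \<beta> * (\<alpha> + \<beta>)) / h)"

definition fam_k :: "'a::field \<Rightarrow> 'a \<Rightarrow> 'a \<Rightarrow> 'a" where
  "fam_k \<alpha> \<beta> lam =
     (let h = fam_h \<alpha> \<beta> lam; t = fam_t \<alpha> \<beta> lam
      in (h * t ^ 2 + (2 * t + \<alpha> + \<beta>) * (h * (\<alpha> + \<beta>) - \<beta> * (\<beta> - \<alpha>) ^ 3)) / h)"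

definition fam_u :: "'a::field \<Rightarrow> 'a \<Rightarrow> 'a \<Rightarrow> 'a" where
  "fam_u \<alpha> \<beta> lam = (\<beta> - \<alpha>) - 9 * (\<alpha> + \<beta>) * lam ^ 3"

definition fam_v :: "'a::field \<Rightarrow> 'a \<Rightarrow> 'a \<Rightarrow> 'a" where
  "fam_v \<alpha> \<beta> lam = \<beta> - \<alpha>"

definition fam_w :: "'a::field \<Rightarrow> 'a \<Rightarrow> 'a \<Rightarrow> 'a" where
  "fam_w \<alpha> \<beta> lam = 3 * (\<beta> - \<alpha>) * lam - 9 * (\<alpha> + \<beta>) * lam ^ 4"

definition fam_z :: "'a::field \<Rightarrow> 'a \<Rightarrow> 'a \<Rightarrow> 'a" where
  "fam_z \<alpha> \<beta> lam = - 9 * (\<alpha> + \<beta>) * lam ^ 4"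

definition fam_points :: "'a::field \<Rightarrow> 'a \<Rightarrow> 'a \<Rightarrow> ('a \<times> 'a) list" where
  "fam_points \<alpha> \<beta> lam =
     (let t = fam_t \<alpha> \<beta> lam
      in [(fam_z \<alpha> \<beta> lam, t + \<alpha>), (fam_w \<alpha> \<beta> lam, t + \<beta>),
          (fam_v \<alpha> \<beta> lam, t + \<alpha> + \<beta>), (fam_u \<alpha> \<beta> lam, t)])"


section \<open>The field \<open>\<rat>(\<alpha>, \<beta>, \<lambda>)\<close> of rational functions\<close>

type_synonym ratfun3 = "rat poly poly poly fract"

definition gen_alpha :: ratfun3 where "gen_alpha = to_fract [:[:[:0, 1:]:]:]"
definition gen_beta :: ratfun3 where "gen_beta = to_fract [:[:0, 1:]:]"
definition gen_lambda :: ratfun3 where "gen_lambda = to_fract [:0, 1:]"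


section \<open>Arithmetic progressions\<close>

text \<open>Constant sequences are not counted as arithmetic progressions.\<close>

definition arith_prog :: "'a::field list \<Rightarrow> bool" where
  "arith_prog xs \<longleftrightarrow>
     (\<exists>a r. r \<noteq> 0 \<and> xs = map (\<lambda>i. a + of_nat i * r) [0..<length xs])"

end

theory Submission
  imports Defs
    "HOL-Library.Set_Algebras"
    "HOL-Computational_Algebra.Field_as_Ring"
    "HOL-Number_Theory.Cong"
begin

text \<open>
  The four points lie on the curve because, after clearing the denominators \<open>h\<close> and
  \<open>h - g\<close>, each incidence is a consequence of one polynomial identity relating \<open>g\<close>, \<open>h\<close> and a
  difference of cubes of abscissas, such as \<open>g = v\<^sup>3 - z\<^sup>3\<close> (lemma \<open>fam_points_on_curve\<close>). For
  \<open>\<alpha> = 2 d\<close>, \<open>\<beta> = - d\<close> the ordinates are \<open>t - d, t, t + d, t + 2 d\<close> (lemma \<open>fam_arith_prog\<close>).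

  For the rank, infinite descent reduces independence of the four points to two facts: the group
  has no element of order 2, and no sum over a nonempty subset of the points is the double of a
  point (lemma \<open>int_independentI\<close>). Both are inherited from one rational fibre,
  \<open>(\<alpha>, \<beta>, \<lambda>) = (1, 2, - 1/3)\<close>, where the curve is \<open>y\<^sup>2 = 27/77 x\<^sup>3 + 711/847\<close>. The abscissa of a
  half of a point with abscissa \<open>X\<close> is a root of the quartic
  \<open>l x\<^sup>4 - 4 l X x\<^sup>3 - 8 k x - 4 k X\<close>. Polynomials over \<open>\<rat>\<close> in three variables form a factorial ring,
  so a root in the generic field specializes to a root in the fibre as soon as the coefficients
  specialize and the leading one does not vanish (lemma \<open>spec_root\<close>). The fifteen quartics of the
  fibre have no rational root, since each has none modulo one of the primes 5, 7, 19; likewise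
  \<open>l x\<^sup>3 + k\<close> has no root modulo 13 (lemma \<open>no_rational_root_mod\<close>). Specialization is used for
  single points and single chords only, never as a homomorphism on the whole group.

  Sums of points make sense in the abelian group of the curve, whose associativity is proved
  without case distinctions on the relative position of three points (lemma \<open>ec_group_comm_group\<close>): a point is
  sent to the class of its maximal ideal in the coordinate ring, this map turns chord-and-tangent
  addition into multiplication of ideal classes (lemma \<open>ec_add_gens\<close>), and it is injective
  (lemma \<open>gens_inj\<close>).
\<close>

section \<open>Ideals of the coordinate ring\<close>

text \<open>
  A commutative ring as a module over itself: spans are ideals.
\<close>
interpretation regular: module "(*) :: 'a::comm_ring_1 \<Rightarrow> 'a \<Rightarrow> 'a"
  by standard (simp_all add: algebra_simps)

text \<open>
  The coordinate ring is represented by polynomials in \<open>y\<close> over polynomials in \<open>x\<close>, taken modulo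
  the curve equation \<open>W\<close>. Its ideals are the ideals \<open>idl S\<close> of the polynomial ring that contain
  \<open>W\<close>, so no quotient type depending on \<open>l\<close> and \<open>k\<close> is needed.
\<close>
locale mordell_curve =
  fixes l k :: "'a::field"
  assumes two: "(2::'a) \<noteq> 0" and three: "(3::'a) \<noteq> 0" and nonsing: "l * k \<noteq> 0"
begin

lemma l0: "l \<noteq> 0" and k0: "k \<noteq> 0"
  using nonsing by auto

definition cubic :: "'a poly" where "cubic = [:k, 0, 0, l:]"

definition W :: "'a poly poly" where "W = [:- cubic, 0, 1:]"

lemma degree_cubic: "degree cubic = 3"
  using l0 by (simp add: cubic_def)

lemma cubic_nz: "cubic \<noteq> 0"
  using degree_cubic by auto

definition idl :: "'a poly poly set \<Rightarrow> 'a poly poly set" where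
  "idl S = regular.span (insert W S)"

lemma idl_base: "s \<in> S \<Longrightarrow> s \<in> idl S"
  by (simp add: idl_def regular.span_base)

lemma idl_W: "W \<in> idl S"
  by (simp add: idl_def regular.span_base)

lemma idl_0: "0 \<in> idl S"
  by (simp add: idl_def regular.span_zero)

lemma idl_add: "a \<in> idl S \<Longrightarrow> b \<in> idl S \<Longrightarrow> a + b \<in> idl S"
  by (simp add: idl_def regular.span_add)

lemma idl_diff: "a \<in> idl S \<Longrightarrow> b \<in> idl S \<Longrightarrow> a - b \<in> idl S"
  by (simp add: idl_def regular.span_diff)

lemma idl_mult: "a \<in> idl S \<Longrightarrow> c * a \<in> idl S"
  by (simp add: idl_def regular.span_scale)

lemma idl_mult2: "a \<in> idl S \<Longrightarrow> a * c \<in> idl S"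
  by (subst mult.commute) (rule idl_mult)

lemma idl_dvd: "W dvd a \<Longrightarrow> a \<in> idl S"
  by (metis dvd_def idl_W idl_mult2)

lemma idl_subset: "T \<subseteq> idl S \<Longrightarrow> idl T \<subseteq> idl S"
  unfolding idl_def by (rule regular.span_minimal) (auto simp: regular.span_base)

lemma idl_eqI: "S \<subseteq> idl T \<Longrightarrow> T \<subseteq> idl S \<Longrightarrow> idl S = idl T"
  by (simp add: idl_subset subset_antisym)

lemma idl_mult_mono:
  assumes "a \<in> idl S" and "\<And>s. s \<in> S \<Longrightarrow> s * t \<in> idl U"
  shows "a * t \<in> idl U"
  using assms(1)[unfolded idl_def]
proof (induction rule: regular.span_induct_alt)
  case base
  show ?case by (simp add: idl_0)
next
  case (step c x y)
  have "x * t \<in> idl U"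
    using step(1) assms(2) by (auto intro: idl_W idl_mult2)
  then have "c * (x * t) + y * t \<in> idl U"
    using step(2) by (rule idl_add[OF idl_mult])
  then show ?case
    by (simp only: distrib_right mult.assoc)
qed

text \<open>
  Hence the product of ideals can be computed on any choice of generators. With the
  elementwise product of sets, products of generating sets form a commutative monoid.
\<close>
lemma idl_times_cong:
  assumes "idl S = idl S'"
  shows "idl (S * T) = idl (S' * T)"
proof -
  have *: "A * T \<subseteq> idl (B * T)" if "idl A = idl B" for A B
  proof
    fix z assume "z \<in> A * T"
    then obtain a t where z: "z = a * t" "a \<in> A" "t \<in> T" by (auto simp: set_times_def)
    have "a \<in> idl B" using that z(2) idl_base by blast
    then show "z \<in> idl (B * T)" unfolding z(1)
      by (rule idl_mult_mono) (use z(3) in \<open>auto intro!: idl_base simp: set_times_def\<close>)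
  qed
  show ?thesis using *[of S S'] *[of S' S] assms by (intro idl_eqI) auto
qed

lemma idl_singleton: "a \<in> idl {b} \<longleftrightarrow> (\<exists>c. W dvd a - c * b)"
proof
  assume "a \<in> idl {b}"
  then show "\<exists>c. W dvd a - c * b" unfolding idl_def
  proof (induction rule: regular.span_induct_alt)
    case base
    show ?case by (rule exI[of _ 0]) simp
  next
    case (step c x y)
    then obtain d where d: "W dvd y - d * b" by auto
    from step(1) show ?case
    proof (elim insertE emptyE)
      assume "x = W"
      with d show ?case by (intro exI[of _ d]) (simp add: add_diff_eq[symmetric])
    next
      assume "x = b"
      with d show ?case by (intro exI[of _ "c + d"]) (simp add: algebra_simps)
    qed
  qed
next
  assume "\<exists>c. W dvd a - c * b"
  then obtain c where "W dvd a - c * b" by auto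
  then have "(a - c * b) + c * b \<in> idl {b}"
    by (intro idl_add[OF idl_dvd idl_mult] idl_base) auto
  then show "a \<in> idl {b}" by simp
qed

text \<open>
  The coordinate ring is free with basis \<open>1, y\<close> over the polynomials in \<open>x\<close>; uniqueness of the
  coefficients is \<open>W_dvd_linear\<close> below.
\<close>
lemma normal_form: "\<exists>a b. W dvd p - [:a, b:]"
proof (induction p)
  case 0
  show ?case by (rule exI[of _ 0], rule exI[of _ 0]) simp
next
  case (pCons c p)
  then obtain a b where "W dvd p - [:a, b:]" by auto
  then have "W dvd [:0, 1:] * (p - [:a, b:]) + [:b:] * W"
    by (rule dvd_add[OF dvd_mult dvd_triv_right])
  also have "[:0, 1:] * (p - [:a, b:]) + [:b:] * W = pCons c p - [:c + b * cubic, a:]"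
    by (simp add: W_def)
  finally show ?case by blast
qed

lemma W_dvd_linear: "W dvd [:a, b:] \<longleftrightarrow> a = 0 \<and> b = 0"
proof
  assume *: "W dvd [:a, b:]"
  show "a = 0 \<and> b = 0"
  proof (rule ccontr)
    assume "\<not> ?thesis"
    then have "[:a, b:] \<noteq> 0" by auto
    with * have "degree W \<le> degree [:a, b:]" by (rule dvd_imp_degree_le)
    then show False by (simp add: W_def split: if_splits)
  qed
qed auto

lemma W_dvd_times:
  "W dvd [:a, b:] * [:c, d:] - [:e, g:] \<longleftrightarrow> a * c + b * d * cubic = e \<and> a * d + b * c = g"
proof -
  have "[:a, b:] * [:c, d:] - [:e, g:] - [:b * d:] * W
      = [:a * c + b * d * cubic - e, a * d + b * c - g:]"
    by (simp add: W_def) (simp add: algebra_simps)?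
  moreover have "W dvd [:a, b:] * [:c, d:] - [:e, g:] - [:b * d:] * W
      \<longleftrightarrow> W dvd [:a, b:] * [:c, d:] - [:e, g:]"
    by (rule dvd_diff_left_iff) (rule dvd_triv_right)
  ultimately show ?thesis
    using W_dvd_linear[of "a * c + b * d * cubic - e" "a * d + b * c - g"] by simp
qed

lemma W_dvd_cong:
  assumes "W dvd p - p'" "W dvd q - q'"
  shows "W dvd (p * q - r) \<longleftrightarrow> W dvd p' * q' - r"
proof -
  have "p * q - r = ((p - p') * q + p' * (q - q')) + (p' * q' - r)" by (simp add: algebra_simps)
  moreover have "W dvd (p - p') * q + p' * (q - q')" using assms by simp
  ultimately show ?thesis by (metis dvd_add_right_iff)
qed

text \<open>
  The norm of \<open>a + b y\<close> from the coordinate ring to the polynomials in \<open>x\<close>.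
\<close>
definition curve_norm :: "'a poly \<Rightarrow> 'a poly \<Rightarrow> 'a poly" where
  "curve_norm a b = a ^ 2 - b ^ 2 * cubic"

lemma curve_norm_mult: "curve_norm (a * c + b * d * cubic) (a * d + b * c) = curve_norm a b * curve_norm c d"
  unfolding curve_norm_def by algebra

text \<open>
  The two summands of the norm have degrees of different parity, so their leading terms
  cannot cancel. In particular the norm of a nonzero element is nonzero, and the coordinate ring is a
  domain (\<open>W_prime\<close>).
\<close>
lemma degree_curve_norm_ge:
  assumes "b \<noteq> 0"
  shows "degree (curve_norm a b) \<ge> 3"
proof -
  have db: "degree (b ^ 2 * cubic) = 2 * degree b + 3"
    using assms cubic_nz degree_cubic by (simp add: degree_mult_eq degree_power_eq)
  have da: "degree (a ^ 2) = 2 * degree a"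
    by (cases "a = 0") (simp_all add: degree_power_eq)
  have "2 * degree a \<noteq> 2 * degree b + 3" by presburger
  then consider "degree (a ^ 2) < degree (b ^ 2 * cubic)" | "degree (b ^ 2 * cubic) < degree (a ^ 2)"
    unfolding da db by linarith
  then show ?thesis
  proof cases
    case 1
    then have "degree (curve_norm a b) = degree (b ^ 2 * cubic)" unfolding curve_norm_def
      using degree_add_eq_right[of "a ^ 2" "- (b ^ 2 * cubic)"] by simp
    then show ?thesis using db by simp
  next
    case 2
    then have "degree (curve_norm a b) = degree (a ^ 2)" unfolding curve_norm_def
      using degree_add_eq_left[of "- (b ^ 2 * cubic)" "a ^ 2"] by simp
    then show ?thesis using 2 db by simp
  qed
qed

lemma curve_norm_eq_0: "curve_norm a b = 0 \<longleftrightarrow> a = 0 \<and> b = 0"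
  using degree_curve_norm_ge[of b a] by (cases "b = 0") (auto simp: curve_norm_def)

lemma W_prime:
  assumes "W dvd p * q"
  shows "W dvd p \<or> W dvd q"
proof -
  obtain a b where p: "W dvd p - [:a, b:]" using normal_form by blast
  obtain c d where q: "W dvd q - [:c, d:]" using normal_form by blast
  have "W dvd [:a, b:] * [:c, d:] - [:0, 0:]"
    using assms W_dvd_cong[OF p q, of 0] by simp
  then have "curve_norm a b * curve_norm c d = 0"
    unfolding W_dvd_times curve_norm_mult[symmetric] by (simp add: curve_norm_eq_0)
  then consider "[:a, b:] = 0" | "[:c, d:] = 0" by (auto simp: curve_norm_eq_0)
  then show ?thesis using p q by cases auto
qed

text \<open>
  Equality in the ideal class group: the ideals agree after scaling by nonzero elements of the
  coordinate ring.
\<close>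
definition idl_equiv :: "'a poly poly set \<Rightarrow> 'a poly poly set \<Rightarrow> bool" (infix "\<sim>" 50) where
  "S \<sim> T \<longleftrightarrow> (\<exists>u v. \<not> W dvd u \<and> \<not> W dvd v \<and> idl ({u} * S) = idl ({v} * T))"

lemma idl_equivI:
  "\<not> W dvd u \<Longrightarrow> \<not> W dvd v \<Longrightarrow> idl ({u} * S) = idl ({v} * T) \<Longrightarrow> S \<sim> T"
  unfolding idl_equiv_def by (intro exI conjI)

lemma not_W_dvd_1: "\<not> W dvd 1"
  using W_dvd_linear[of 1 0] by (simp add: pCons_one)

lemma equivI: "idl S = idl T \<Longrightarrow> S \<sim> T"
  unfolding idl_equiv_def using not_W_dvd_1 set_one[where 'a = "'a poly poly"]
  by (intro exI[of _ 1]) (simp del: set_one)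

lemma equiv_refl: "S \<sim> S"
  by (rule equivI) simp

lemma equiv_sym: "S \<sim> T \<Longrightarrow> T \<sim> S"
  unfolding idl_equiv_def by metis

lemma singleton_times: "{u * v} = {u} * {v}" for u v :: "'a poly poly"
  by (auto simp: set_times_def)

lemma equiv_trans [trans]:
  assumes "S \<sim> T" "T \<sim> U" shows "S \<sim> U"
proof -
  obtain u v where uv: "\<not> W dvd u" "\<not> W dvd v" "idl ({u} * S) = idl ({v} * T)"
    using assms(1) by (auto simp: idl_equiv_def)
  obtain u' v' where uv': "\<not> W dvd u'" "\<not> W dvd v'" "idl ({u'} * T) = idl ({v'} * U)"
    using assms(2) by (auto simp: idl_equiv_def)
  have "idl ({u * u'} * S) = idl ({u} * S * {u'})"
    by (simp add: singleton_times mult_ac)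
  also have "\<dots> = idl ({u'} * T * {v})"
    using idl_times_cong[OF uv(3), of "{u'}"] by (simp only: mult_ac)
  also have "\<dots> = idl ({v'} * U * {v})"
    by (rule idl_times_cong[OF uv'(3)])
  also have "{v'} * U * {v} = {v * v'} * U"
    by (simp only: singleton_times mult_ac)
  finally have "idl ({u * u'} * S) = idl ({v * v'} * U)" .
  moreover have "\<not> W dvd u * u'" "\<not> W dvd v * v'"
    using uv(1,2) uv'(1,2) by (auto dest: W_prime)
  ultimately show ?thesis by (intro idl_equivI)
qed

lemma equiv_times:
  assumes "S \<sim> S'" shows "S * T \<sim> S' * T"
proof -
  obtain u v where uv: "\<not> W dvd u" "\<not> W dvd v" "idl ({u} * S) = idl ({v} * S')"
    using assms(1) by (auto simp: idl_equiv_def)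
  have "idl ({u} * (S * T)) = idl ({v} * (S' * T))"
    using idl_times_cong[OF uv(3), of T] by (simp only: mult.assoc)
  with uv(1,2) show ?thesis by (rule idl_equivI)
qed

lemma principal_equiv:
  assumes "\<not> W dvd u" shows "{u} \<sim> 1"
proof -
  have "idl ({1} * {u}) = idl ({u} * {1})"
    by (simp only: mult.commute)
  with not_W_dvd_1 assms show ?thesis
    unfolding set_one by (rule idl_equivI)
qed

section \<open>Point ideals and collinear points\<close>

text \<open>
  Generators of the maximal ideal of a point; the point at infinity gets the unit ideal.
\<close>
fun gens :: "'a ec_point \<Rightarrow> 'a poly poly set" where
  "gens Infinity = 1"
| "gens (Affine x y) = {[:[:- x, 1:]:], [:[:- y:], 1:]}"

lemma pair_times: "{a, b} * {c, d} = {a * c, a * d, b * c, b * d}" for a b c d :: "'a poly poly"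
  by (auto simp: set_times_def)

lemma idl_cancel_const:
  assumes "[:[:c:]:] * a \<in> idl S" "c \<noteq> 0"
  shows "a \<in> idl S"
proof -
  have "[:[:1 / c:]:] * ([:[:c:]:] * a) \<in> idl S"
    using assms(1) by (rule idl_mult)
  then show ?thesis using assms(2) by (simp add: mult.assoc[symmetric] pCons_one)
qed

text \<open>
  The product of the two point ideals is generated by \<open>x - x\<^sub>0\<close>. Every product of generators is a
  multiple of it; conversely it is a combination of them because the curve is smooth at the
  point: either the ordinate is nonzero, or it vanishes and then \<open>3 x\<^sub>0\<^sup>2\<close> does not.
\<close>
lemma gens_opposite:
  assumes "y0 ^ 2 = l * x0 ^ 3 + k"
  shows "gens (Affine x0 y0) * gens (Affine x0 (- y0)) \<sim> 1"
proof -
  define A :: "'a poly poly" where "A = [:[:- x0, 1:]:]"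
  define B :: "'a poly poly" where "B = [:[:- y0:], 1:]"
  define B' :: "'a poly poly" where "B' = [:[:y0:], 1:]"
  define Q :: "'a poly poly" where "Q = [:smult l [:x0\<^sup>2, x0, 1:]:]"
  let ?I = "{A * A, A * B', B * A, B * B'}"
  have BB: "B * B' = W + Q * A"
    unfolding A_def B_def B'_def Q_def W_def cubic_def
    by simp (use assms in \<open>simp add: power2_eq_square power3_eq_cube\<close>)
  have AA: "A * A \<in> idl ?I" "A * B' \<in> idl ?I" "B * A \<in> idl ?I" "B * B' \<in> idl ?I"
    by (simp_all add: idl_base)
  have "A \<in> idl ?I"
  proof (cases "y0 = 0")
    case True
    then have x0: "x0 \<noteq> 0" using assms k0 by auto
    have "B * B' - W - [:[:l:]:] * [:[:2 * x0, 1:]:] * (A * A) \<in> idl ?I"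
      by (rule AA idl_W idl_diff idl_mult)+
    also have "B * B' - W - [:[:l:]:] * [:[:2 * x0, 1:]:] * (A * A) = [:[:3 * l * x0\<^sup>2:]:] * A"
      unfolding BB unfolding A_def Q_def
      by simp (simp add: algebra_simps power2_eq_square)
    finally show ?thesis
      by (rule idl_cancel_const) (use x0 l0 three in simp)
  next
    case False
    have "A * B' - B * A \<in> idl ?I"
      by (rule AA idl_diff)+
    also have "A * B' - B * A = [:[:2 * y0:]:] * A"
      unfolding A_def B_def B'_def by simp
    finally show ?thesis
      by (rule idl_cancel_const) (use False two in simp)
  qed
  moreover have "A \<in> idl {A}"
    by (rule idl_base) simp
  then have "?I \<subseteq> idl {A}"
    unfolding BB by (simp only: insert_subset empty_subsetI idl_add idl_W idl_mult idl_mult2 simp_thms)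
  ultimately have "idl ?I = idl {A}"
    by (intro idl_eqI) auto
  moreover have "\<not> W dvd A"
    using W_dvd_linear[of "[:- x0, 1:]" 0] by (simp add: A_def)
  moreover have "gens (Affine x0 y0) * gens (Affine x0 (- y0)) = ?I"
    by (simp add: pair_times A_def B_def B'_def)
  ultimately show ?thesis
    using equiv_trans equivI principal_equiv by metis
qed

text \<open>
  The line \<open>y = m x + c\<close> meets the curve at the abscissas \<open>x1, x2, x3\<close>, counted with
  multiplicity, iff the stated factorization holds; here it is compared coefficientwise.
\<close>
lemma collinear_coeffs:
  "smult l ([:- x1, 1:] * [:- x2, 1:] * [:- x3, 1:]) = cubic - [:c, m:] ^ 2 \<longleftrightarrow>
    l * x1 * x2 * x3 = c\<^sup>2 - k \<and> l * (x1 * x2 + x1 * x3 + x2 * x3) = - 2 * m * c \<and> l * (x1 + x2 + x3) = m\<^sup>2"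
proof -
  have "smult l ([:- x1, 1:] * [:- x2, 1:] * [:- x3, 1:])
      = [:- (l * x1 * x2 * x3), l * (x1 * x2 + x1 * x3 + x2 * x3), - (l * (x1 + x2 + x3)), l:]"
    by simp algebra
  moreover have "cubic - [:c, m:] ^ 2 = [:- (c\<^sup>2 - k), - 2 * m * c, - m\<^sup>2, l:]"
    by (simp add: cubic_def power2_eq_square)
  ultimately show ?thesis by (simp only: pCons_eq_iff neg_equal_iff_equal) auto
qed

text \<open>
  At a common zero of the three generators the line meets the curve in a point with
  \<open>y = m x + c = 0\<close> that is a multiple root of the cubic, which smoothness rules out. The proof
  carries out this argument by successively finding the elements \<open>s\<^sup>2\<close> (with \<open>s = m x + c\<close>), the
  cubic, the square of its derivative, \<open>x\<close> and finally \<open>1\<close> in the ideal. Arguing with ideals instead of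
  points covers tangents and inflections without separate cases.
\<close>
lemma line_unit_ideal:
  assumes line: "smult l ([:- x1, 1:] * [:- x2, 1:] * [:- x3, 1:]) = cubic - [:c, m:] ^ 2"
  defines "L \<equiv> [:- [:c, m:], 1:]" and "L' \<equiv> [:[:c, m:], 1:]"
    and "E \<equiv> [:[:- x1, 1:] * [:- x2, 1:] + [:- x1, 1:] * [:- x3, 1:] + [:- x2, 1:] * [:- x3, 1:]:]"
  shows "1 \<in> idl {L', L * L, E}"
proof -
  let ?J = "idl {L', L * L, E}"
  define s :: "'a poly poly" where "s = [:[:c, m:]:]"
  define X :: "'a poly poly" where "X = [:[:0, 1:]:]"
  have J: "L' \<in> ?J" "L * L \<in> ?J" "E \<in> ?J"
    by (simp_all add: idl_base)
  have "L' * L' - 2 * L * L' + L * L \<in> ?J"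
    by (rule J idl_add idl_diff idl_mult)+
  also have "L' * L' - 2 * L * L' + L * L = (L' - L) * (L' - L)"
    by algebra
  also have "L' - L = [:[:2:]:] * s"
    by (simp add: L_def L'_def s_def)
  also have "[:[:2:]:] * s * ([:[:2:]:] * s) = [:[:4:]:] * (s * s)"
    by (simp add: s_def)
  finally have s2: "s * s \<in> ?J"
  proof (rule idl_cancel_const)
    have "(4::'a) = 2 * 2" by simp
    then show "(4::'a) \<noteq> 0" using two by (metis mult_eq_0_iff)
  qed
  have "L' * L' - s * L' - s * L' + s * s - W \<in> ?J"
    by (rule J s2 idl_W idl_add idl_diff idl_mult)+
  also have "L' * L' - s * L' - s * L' + s * s - W = [:cubic:]"
    by (simp add: L'_def s_def W_def)
  finally have C: "[:cubic:] \<in> ?J" .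
  have "l * (x1 * x2 + x1 * x3 + x2 * x3) = - 2 * m * c" "l * (x1 + x2 + x3) = m\<^sup>2"
    using line by (simp_all only: collinear_coeffs)
  then have "pderiv cubic = smult l ([:- x1, 1:] * [:- x2, 1:] + [:- x1, 1:] * [:- x3, 1:]
      + [:- x2, 1:] * [:- x3, 1:]) + smult (2 * m) [:c, m:]"
    by (simp add: cubic_def pderiv_pCons) algebra
  then have D: "[:pderiv cubic:] = [:[:l:]:] * E + [:[:2 * m:]:] * s"
    by (simp add: E_def s_def)
  have "([:[:l:]:] * E + 2 * ([:[:2 * m:]:] * s)) * [:[:l:]:] * E
      + [:[:2 * m:]:] * [:[:2 * m:]:] * (s * s) \<in> ?J"
    by (rule J s2 idl_add idl_mult)+
  also have "([:[:l:]:] * E + 2 * ([:[:2 * m:]:] * s)) * [:[:l:]:] * E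
      + [:[:2 * m:]:] * [:[:2 * m:]:] * (s * s) = [:pderiv cubic:] * [:pderiv cubic:]"
    unfolding D by algebra
  finally have D2: "[:pderiv cubic:] * [:pderiv cubic:] \<in> ?J" .
  have "[:[:9 * l:]:] * X * [:cubic:] - [:pderiv cubic:] * [:pderiv cubic:] \<in> ?J"
    by (rule C D2 idl_diff idl_mult)+
  also have "[:[:9 * l:]:] * X * [:cubic:] - [:pderiv cubic:] * [:pderiv cubic:] = [:[:9 * l * k:]:] * X"
    by (simp add: X_def cubic_def pderiv_pCons)
  finally have X: "X \<in> ?J"
  proof (rule idl_cancel_const)
    have "(9::'a) = 3 * 3" by simp
    then show "9 * l * k \<noteq> 0" using three l0 k0 by (metis mult_eq_0_iff)
  qed
  have "[:cubic:] - [:[:l:]:] * X * X * X \<in> ?J"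
    by (rule C X idl_diff idl_mult)+
  also have "[:cubic:] - [:[:l:]:] * X * X * X = [:[:k:]:] * 1"
    by (simp add: X_def cubic_def)
  finally show "1 \<in> ?J"
    by (rule idl_cancel_const) (rule k0)
qed

text \<open>
  On the curve \<open>(y - s) (y + s) = l (x - x1) (x - x2) (x - x3)\<close> for the line \<open>y = s\<close>, so every
  product of generators is a multiple of \<open>L = y - s\<close>. That \<open>L\<close> itself lies in the product is the
  content of \<open>line_unit_ideal\<close>: the ideal there, multiplied by \<open>L\<close>, is contained in it.
\<close>
lemma gens_collinear:
  assumes line: "smult l ([:- x1, 1:] * [:- x2, 1:] * [:- x3, 1:]) = cubic - [:c, m:] ^ 2"
  shows "gens (Affine x1 (m * x1 + c)) * gens (Affine x2 (m * x2 + c)) * gens (Affine x3 (m * x3 + c)) \<sim> 1"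
proof -
  define A where "A x = [:[:- x, 1:]:]" for x :: 'a
  define L :: "'a poly poly" where "L = [:- [:c, m:], 1:]"
  define L' :: "'a poly poly" where "L' = [:[:c, m:], 1:]"
  let ?G = "\<lambda>x. gens (Affine x (m * x + c))"
  have G: "idl (?G x) = idl {A x, L}" for x
  proof -
    define B :: "'a poly poly" where "B = [:[:- (m * x + c):], 1:]"
    have B: "B = L + [:[:m:]:] * A x"
      by (simp add: B_def L_def A_def)
    then have L: "L = B - [:[:m:]:] * A x" by simp
    have "B \<in> idl {A x, L}"
      unfolding B by (rule idl_add[OF idl_base idl_mult[OF idl_base]]) auto
    moreover have "L \<in> idl {A x, B}"
      unfolding L by (rule idl_diff[OF idl_base idl_mult[OF idl_base]]) auto
    ultimately have "idl {A x, B} = idl {A x, L}"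
      by (intro idl_eqI) (auto intro: idl_base)
    then show ?thesis by (simp add: A_def B_def)
  qed
  let ?P = "{A x1, L} * {A x2, L} * {A x3, L}"
  have "idl (?G x1 * ?G x2 * ?G x3) = idl ({A x1, L} * ?G x2 * ?G x3)"
    by (intro idl_times_cong G)
  also have "\<dots> = idl (?G x2 * ({A x1, L} * ?G x3))"
    by (simp only: mult_ac)
  also have "\<dots> = idl ({A x2, L} * ({A x1, L} * ?G x3))"
    by (intro idl_times_cong G)
  also have "\<dots> = idl (?G x3 * ({A x1, L} * {A x2, L}))"
    by (simp only: mult_ac)
  also have "\<dots> = idl ({A x3, L} * ({A x1, L} * {A x2, L}))"
    by (intro idl_times_cong G)
  also have "\<dots> = idl ?P"
    by (simp only: mult_ac)
  finally have 1: "idl (?G x1 * ?G x2 * ?G x3) = idl ?P" .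
  have P: "a * b * c \<in> idl ?P" if "a \<in> {A x1, L}" "b \<in> {A x2, L}" "c \<in> {A x3, L}" for a b c
    using that by (intro idl_base) (auto simp: set_times_def)
  have "[:[:l:]:] * (A x1 * A x2 * A x3) = [:smult l ([:- x1, 1:] * [:- x2, 1:] * [:- x3, 1:]):]"
    by (simp add: A_def)
  moreover have "L' * L - W = [:cubic - [:c, m:] ^ 2:]"
    by (simp add: L_def L'_def W_def power2_eq_square)
  ultimately have AAA: "[:[:l:]:] * (A x1 * A x2 * A x3) = L' * L - W"
    by (simp only: line)
  define E :: "'a poly poly" where
    "E = [:[:- x1, 1:] * [:- x2, 1:] + [:- x1, 1:] * [:- x3, 1:] + [:- x2, 1:] * [:- x3, 1:]:]"
  have E: "E = A x1 * A x2 + A x1 * A x3 + A x2 * A x3"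
    by (simp add: E_def A_def)
  have "L' * L = [:[:l:]:] * (A x1 * A x2 * A x3) + W"
    using AAA by simp
  then have "L' * L \<in> idl ?P"
    by (simp only:) (rule idl_add[OF idl_mult[OF P] idl_W], simp_all)
  moreover have "L * L * L \<in> idl ?P"
    by (rule P) auto
  moreover have "E * L = A x1 * A x2 * L + A x1 * L * A x3 + L * A x2 * A x3"
    unfolding E by algebra
  then have "E * L \<in> idl ?P"
    by (simp add: idl_add P)
  moreover have "1 \<in> idl {L', L * L, E}"
    unfolding L_def L'_def E_def using line by (rule line_unit_ideal)
  ultimately have "1 * L \<in> idl ?P"
    by (elim idl_mult_mono) (elim insertE emptyE; simp only:)
  moreover have "?P \<subseteq> idl {L}"
  proof
    fix z assume "z \<in> ?P"
    then obtain a b d where z: "z = a * b * d" "a \<in> {A x1, L}" "b \<in> {A x2, L}" "d \<in> {A x3, L}"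
      unfolding set_times_def by blast
    then consider "z = A x1 * A x2 * A x3" | "z = b * d * L" | "z = a * d * L" | "z = a * b * L"
      by (auto simp only: insert_iff empty_iff mult_ac)
    then show "z \<in> idl {L}"
    proof cases
      case 1
      have "[:[:l:]:] * z \<in> idl {L}"
        unfolding 1 AAA by (rule idl_diff[OF idl_mult[OF idl_base] idl_W]) simp
      then show ?thesis by (rule idl_cancel_const) (rule l0)
    qed (simp_all only: idl_mult idl_base insertI1)
  qed
  ultimately have "idl ?P = idl {L}"
    by (intro idl_eqI) auto
  moreover have "\<not> W dvd L"
    by (simp add: L_def W_dvd_linear)
  ultimately show ?thesis
    using 1 equiv_trans equivI principal_equiv by metis
qed

section \<open>The group of points\<close>

lemma idl_singleton_times:
  assumes "z \<in> idl ({u} * S)"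
  shows "\<exists>w\<in>idl S. W dvd z - u * w"
  using assms[unfolded idl_def]
proof (induction rule: regular.span_induct_alt)
  case base
  show ?case by (rule bexI[of _ 0]) (simp_all add: idl_0)
next
  case (step c x y)
  then obtain w where w: "w \<in> idl S" "W dvd y - u * w" by blast
  from step(1) consider "x = W" | s where "s \<in> S" "x = u * s"
    by (auto simp: set_times_def)
  then show ?case
  proof cases
    case 1
    have "c * x + y - u * w = W * c + (y - u * w)" unfolding 1 by algebra
    with w show ?thesis by (intro bexI[of _ w]) (simp_all only: dvd_add dvd_triv_left)
  next
    case 2
    have "c * x + y - u * (c * s + w) = y - u * w" unfolding 2 by algebra
    moreover have "c * s + w \<in> idl S"
      by (rule idl_add[OF idl_mult[OF idl_base[OF 2(1)]] w(1)])
    ultimately show ?thesis using w(2) by (intro bexI[of _ "c * s + w"]) (simp_all only:)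
  qed
qed

text \<open>
  A trivial ideal class means an honest principal ideal, since the scaling factor cancels in a
  domain. The generator is given in normal form.
\<close>
lemma principal_generator:
  assumes "S \<sim> 1"
  obtains a b where "[:a, b:] \<in> idl S" "\<And>s. s \<in> S \<Longrightarrow> \<exists>c d. W dvd [:a, b:] * [:c, d:] - s"
proof -
  obtain u v where uv: "\<not> W dvd u" "idl ({u} * S) = idl ({v} * 1)"
    using assms unfolding idl_equiv_def by blast
  have v: "{v} * 1 = {v}" by (simp del: set_one)
  have "v \<in> idl ({u} * S)"
    unfolding uv(2) v by (rule idl_base) simp
  then obtain w where w: "w \<in> idl S" "W dvd v - u * w"
    using idl_singleton_times by blast
  obtain a b where ab: "W dvd w - [:a, b:]" using normal_form by blast
  show ?thesis
  proof (rule that)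
    have "w - (w - [:a, b:]) \<in> idl S" by (rule idl_diff[OF w(1) idl_dvd[OF ab]])
    then show "[:a, b:] \<in> idl S" by simp
    fix s assume "s \<in> S"
    then have "u * s \<in> idl ({u} * S)" by (intro idl_base) (auto simp: set_times_def)
    then obtain e where e: "W dvd u * s - e * v"
      unfolding uv(2) v idl_singleton by blast
    obtain c d where cd: "W dvd e - [:c, d:]" using normal_form by blast
    have "u * (w * e - s) = - ((u * s - e * v) + e * (v - u * w))"
      by algebra
    also have "W dvd \<dots>" using e w(2) by (simp only: dvd_minus_iff dvd_add dvd_mult)
    finally have "W dvd w * e - s" using uv(1) W_prime by blast
    then have "W dvd [:a, b:] * [:c, d:] - s"
      by (simp only: W_dvd_cong[OF ab cd])
    then show "\<exists>c d. W dvd [:a, b:] * [:c, d:] - s" by blast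
  qed
qed

definition eval_at :: "'a \<Rightarrow> 'a \<Rightarrow> 'a poly poly \<Rightarrow> 'a" where
  "eval_at x y p = poly (poly p [:y:]) x"

lemma idl_vanish:
  assumes "z \<in> idl S" "y ^ 2 = l * x ^ 3 + k" "\<And>s. s \<in> S \<Longrightarrow> eval_at x y s = 0"
  shows "eval_at x y z = 0"
  using assms(1)[unfolded idl_def]
proof (induction rule: regular.span_induct_alt)
  case (step c z z')
  have "eval_at x y W = 0"
    by (simp add: eval_at_def W_def cubic_def) (use assms(2) in algebra)
  with step assms(3) show ?case by (auto simp: eval_at_def)
qed (simp add: eval_at_def)

text \<open>
  If both factors involved \<open>y\<close>, the norm of their product would have degree at least 6,
  but it is \<open>h\<^sup>2\<close>. If only the first one did, the product would involve \<open>y\<close> as well.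
\<close>
lemma generator_const:
  assumes "W dvd [:a, b:] * [:c, d:] - [:h:]" "h \<noteq> 0" "degree h \<le> 2"
  shows "b = 0"
proof (rule ccontr)
  assume b: "b \<noteq> 0"
  have eqs: "a * c + b * d * cubic = h" "a * d + b * c = 0"
    using W_dvd_times[of a b c d h 0] assms(1) by simp_all
  have d: "d \<noteq> 0"
  proof
    assume "d = 0"
    with eqs b assms(2) show False by auto
  qed
  have "curve_norm a b * curve_norm c d = h ^ 2"
    unfolding curve_norm_mult[symmetric] eqs by (simp add: curve_norm_def)
  then have "degree (curve_norm a b) + degree (curve_norm c d) = degree (h ^ 2)"
    using b d by (metis degree_mult_eq curve_norm_eq_0)
  also have "\<dots> \<le> 4" using assms(3) by (simp add: degree_power_eq assms(2))
  finally show False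
    using degree_curve_norm_ge[OF b, of a] degree_curve_norm_ge[OF d, of c] by linarith
qed

lemma gens_not_principal:
  assumes "y0 ^ 2 = l * x0 ^ 3 + k"
  shows "\<not> gens (Affine x0 y0) \<sim> 1"
proof
  assume "gens (Affine x0 y0) \<sim> 1"
  then obtain a b where ab: "[:a, b:] \<in> idl (gens (Affine x0 y0))"
    "\<And>s. s \<in> gens (Affine x0 y0) \<Longrightarrow> \<exists>c d. W dvd [:a, b:] * [:c, d:] - s"
    by (rule principal_generator) blast
  have "\<exists>c d. W dvd [:a, b:] * [:c, d:] - [:[:- x0, 1:]:]"
    by (rule ab(2)) simp
  then obtain c d where "W dvd [:a, b:] * [:c, d:] - [:[:- x0, 1:]:]" by blast
  then have b: "b = 0" by (rule generator_const) simp_all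
  have "eval_at x0 y0 [:a, b:] = 0"
    by (rule idl_vanish[OF ab(1) assms]) (auto simp: eval_at_def)
  then have a: "poly a x0 = 0" using b by (simp add: eval_at_def)
  have "\<exists>c d. W dvd [:a, b:] * [:c, d:] - [:[:- y0:], 1:]"
    by (rule ab(2)) simp
  then obtain d where "a * d = 1" unfolding W_dvd_times b by auto
  then have "poly (a * d) x0 = 1" by simp
  with a show False by simp
qed

text \<open>
  A generator is a polynomial \<open>a\<close> in \<open>x\<close> by \<open>generator_const\<close>, and it vanishes at both abscissas. It
  divides the generators \<open>(x - x0) (y - y1)\<close> and \<open>(y - y0) (y - y1)\<close>, hence also their coefficients
  of \<open>y\<close>, which are \<open>x - x0\<close> and, modulo the curve equation, \<open>- y0 - y1\<close>; evaluating these at the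
  abscissas gives the claim.
\<close>
lemma gens_times_principal:
  assumes on: "y0 ^ 2 = l * x0 ^ 3 + k" "y1 ^ 2 = l * x1 ^ 3 + k"
    and equiv: "gens (Affine x0 y0) * gens (Affine x1 y1) \<sim> 1"
  shows "x1 = x0 \<and> y1 = - y0"
proof -
  let ?S = "gens (Affine x0 y0) * gens (Affine x1 y1)"
  obtain a b where ab: "[:a, b:] \<in> idl ?S"
    "\<And>s. s \<in> ?S \<Longrightarrow> \<exists>c d. W dvd [:a, b:] * [:c, d:] - s"
    using equiv by (rule principal_generator) blast
  have S: "?S = {[:[:- x0, 1:]:] * [:[:- x1, 1:]:], [:[:- x0, 1:]:] * [:[:- y1:], 1:],
      [:[:- y0:], 1:] * [:[:- x1, 1:]:], [:[:- y0:], 1:] * [:[:- y1:], 1:]}"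
    by (simp only: gens.simps pair_times)
  have AA: "[:[:- x0, 1:]:] * [:[:- x1, 1:]:] = [:[:- x0, 1:] * [:- x1, 1:]:]"
    and AB: "[:[:- x0, 1:]:] * [:[:- y1:], 1:] = [:smult (- y1) [:- x0, 1:], [:- x0, 1:]:]"
    by simp_all
  have "\<exists>c d. W dvd [:a, b:] * [:c, d:] - [:[:- x0, 1:] * [:- x1, 1:]:]"
    by (rule ab(2)) (simp only: S AA insert_iff simp_thms)
  then obtain c d where "W dvd [:a, b:] * [:c, d:] - [:[:- x0, 1:] * [:- x1, 1:]:]" by blast
  then have b: "b = 0" by (rule generator_const) simp_all
  have "eval_at x0 y0 [:a, b:] = 0"
    by (rule idl_vanish[OF ab(1) on(1)], unfold S) (auto simp: eval_at_def, simp_all add: algebra_simps)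
  then have a0: "poly a x0 = 0" using b by (simp add: eval_at_def)
  have "eval_at x1 y1 [:a, b:] = 0"
    by (rule idl_vanish[OF ab(1) on(2)], unfold S) (auto simp: eval_at_def, simp_all add: algebra_simps)
  then have a1: "poly a x1 = 0" using b by (simp add: eval_at_def)
  have "\<exists>c d. W dvd [:a, b:] * [:c, d:] - [:smult (- y1) [:- x0, 1:], [:- x0, 1:]:]"
    by (rule ab(2)) (simp only: S AB insert_iff simp_thms)
  then obtain d where "a * d = [:- x0, 1:]" unfolding W_dvd_times b by auto
  then have "poly (a * d) x1 = x1 - x0" by simp
  with a1 have x: "x1 = x0" by simp
  have "\<exists>c d. W dvd [:a, b:] * [:c, d:] - [:[:- y0:], 1:] * [:[:- y1:], 1:]"
    by (rule ab(2)) (simp only: S insert_iff simp_thms)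
  then obtain c d where "W dvd [:a, b:] * [:c, d:] - [:[:- y0:], 1:] * [:[:- y1:], 1:]" by blast
  then have "W dvd ([:a, b:] * [:c, d:] - [:[:- y0:], 1:] * [:[:- y1:], 1:]) + W"
    by (rule dvd_add) simp
  also have "([:a, b:] * [:c, d:] - [:[:- y0:], 1:] * [:[:- y1:], 1:]) + W
      = [:a, b:] * [:c, d:] - [:cubic + [:y0 * y1:], [:- y0 - y1:]:]"
    by (simp add: W_def)
  finally have "a * d = [:- y0 - y1:]" unfolding W_dvd_times b by simp
  then have "poly (a * d) x0 = - y0 - y1" by simp
  with a0 x show ?thesis by (simp add: eq_neg_iff_add_eq_0 add.commute)
qed

fun opposite :: "'a ec_point \<Rightarrow> 'a ec_point" where
  "opposite Infinity = Infinity"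
| "opposite (Affine x y) = Affine x (- y)"

lemma Affine_in_ec_points [simp]:
  "Affine x y \<in> ec_points l k \<longleftrightarrow> y ^ 2 = l * x ^ 3 + k"
  by (auto simp: ec_points_def affine_curve_def)

lemma Infinity_in_ec_points [simp]: "Infinity \<in> ec_points l k"
  by (simp add: ec_points_def)

lemma opposite_closed: "P \<in> ec_points l k \<Longrightarrow> opposite P \<in> ec_points l k"
  by (cases P) auto

lemma gens_times_opposite:
  assumes "P \<in> ec_points l k"
  shows "gens P * gens (opposite P) \<sim> 1"
proof (cases P)
  case Infinity
  then show ?thesis using equiv_refl[of 1] by (simp del: set_one)
next
  case (Affine x y)
  with assms show ?thesis
    using gens_opposite[of y x] by (simp del: gens.simps)
qed

text \<open>
  Multiplying by the ideal of the opposite point makes the statement one about trivial classes.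
\<close>
lemma gens_inj:
  assumes P: "P \<in> ec_points l k" and Q: "Q \<in> ec_points l k" and PQ: "gens P \<sim> gens Q"
  shows "P = Q"
proof (cases P)
  case Infinity
  then show ?thesis
  proof (cases Q)
    case (Affine x y)
    then show ?thesis
      using Infinity PQ Q equiv_sym gens_not_principal[of y x] by auto
  qed simp
next
  case (Affine x y)
  then have P': "y ^ 2 = l * x ^ 3 + k" using P by simp
  show ?thesis
  proof (cases Q)
    case Infinity
    then show ?thesis
      using Affine PQ P' gens_not_principal[of y x] by auto
  next
    case (Affine x' y')
    then have Q': "y' ^ 2 = l * x' ^ 3 + k" using Q by simp
    have "gens P * gens (opposite Q) \<sim> gens Q * gens (opposite Q)"
      by (rule equiv_times[OF PQ])
    also have "\<dots> \<sim> 1" by (rule gens_times_opposite[OF Q])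
    finally show ?thesis
      using gens_times_principal[of y x "- y'" x'] P' Q' \<open>P = Affine x y\<close> Affine
      by (simp del: gens.simps)
  qed
qed

text \<open>
  The assumption \<open>mid\<close> is the linear coefficient of \<open>collinear_coeffs\<close>. The quadratic one is the
  definition of the third abscissa, and the constant one follows because the first point lies on the
  curve.
\<close>
lemma ec_third_gens:
  assumes on: "y1 ^ 2 = l * x1 ^ 3 + k" "y2 ^ 2 = l * x2 ^ 3 + k"
    and y2: "y2 = y1 + m * (x2 - x1)"
    and mid: "l * (x1 * x2 + (x1 + x2) * (m\<^sup>2 / l - x1 - x2)) = - 2 * m * (y1 - m * x1)"
  shows "ec_third l m x1 y1 x2 \<in> ec_points l k \<and>
    gens (ec_third l m x1 y1 x2) \<sim> gens (Affine x1 y1) * gens (Affine x2 y2)"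
proof -
  define x3 where "x3 = m\<^sup>2 / l - x1 - x2"
  define c where "c = y1 - m * x1"
  let ?P = "Affine x1 y1" and ?Q = "Affine x2 y2" and ?T = "Affine x3 (m * x3 + c)"
  have eqs: "y1 = m * x1 + c" "y2 = m * x2 + c"
    using y2 by (simp_all add: c_def algebra_simps)
  have sum: "l * (x1 + x2 + x3) = m\<^sup>2"
    using l0 by (simp add: x3_def)
  have mid': "l * (x1 * x2 + x1 * x3 + x2 * x3) = - 2 * m * c"
    using mid unfolding x3_def[symmetric] c_def[symmetric] by algebra
  have prod: "l * x1 * x2 * x3 = c\<^sup>2 - k"
    using on(1) sum mid' unfolding eqs(1) by algebra
  have line: "smult l ([:- x1, 1:] * [:- x2, 1:] * [:- x3, 1:]) = cubic - [:c, m:] ^ 2"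
    using sum mid' prod by (simp only: collinear_coeffs simp_thms)
  have "(m * x3 + c) ^ 2 = l * x3 ^ 3 + k"
    using sum mid' prod by algebra
  then have T: "?T \<in> ec_points l k" by simp
  have "y1 + m * (x3 - x1) = m * x3 + c"
    unfolding c_def by algebra
  then have third: "ec_third l m x1 y1 x2 = opposite ?T"
    unfolding ec_third_def x3_def[symmetric] Let_def by (simp only: opposite.simps)
  have "gens (opposite ?T) * (gens ?P * gens ?Q * gens ?T) \<sim> gens (opposite ?T)"
    using equiv_times[OF gens_collinear[OF line], of "gens (opposite ?T)"]
    unfolding eqs mult_1 by (simp only: mult.commute)
  moreover have "gens (opposite ?T) * (gens ?P * gens ?Q * gens ?T) \<sim> gens ?P * gens ?Q"
    using equiv_times[OF gens_times_opposite[OF T], of "gens ?P * gens ?Q"]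
    unfolding mult_1 by (simp only: mult_ac)
  ultimately have "gens (opposite ?T) \<sim> gens ?P * gens ?Q"
    using equiv_trans equiv_sym by blast
  then show ?thesis
    unfolding third using opposite_closed[OF T] by simp
qed

lemma ec_add_gens:
  assumes P: "P \<in> ec_points l k" and Q: "Q \<in> ec_points l k"
  shows "ec_add l P Q \<in> ec_points l k \<and> gens (ec_add l P Q) \<sim> gens P * gens Q"
proof (cases P)
  case Infinity
  then show ?thesis using Q equiv_refl[of "gens Q"] by (simp del: set_one)
next
  case P1: (Affine x1 y1)
  show ?thesis
  proof (cases Q)
    case Infinity
    then show ?thesis using P P1 equiv_refl[of "gens P"] by (simp del: set_one)
  next
    case Q1: (Affine x2 y2)
    have on: "y1 ^ 2 = l * x1 ^ 3 + k" "y2 ^ 2 = l * x2 ^ 3 + k"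
      using P Q P1 Q1 by simp_all
    consider "x1 \<noteq> x2" | "x1 = x2" "y1 = - y2" | "x1 = x2" "y1 \<noteq> - y2" by blast
    then show ?thesis
    proof cases
      case 1
      define m where "m = (y2 - y1) / (x2 - x1)"
      have m: "m * (x2 - x1) = y2 - y1" using 1 by (simp add: m_def)
      have "(x2 - x1) * (l * (x1 * x2) + (x1 + x2) * (m\<^sup>2 - l * (x1 + x2)) + 2 * m * (y1 - m * x1)) = 0"
        using m on by algebra
      then have "l * (x1 * x2) + (x1 + x2) * (m\<^sup>2 - l * (x1 + x2)) + 2 * m * (y1 - m * x1) = 0"
        using 1 by simp
      moreover have "l * (m\<^sup>2 / l) = m\<^sup>2" using l0 by simp
      ultimately have "l * (x1 * x2 + (x1 + x2) * (m\<^sup>2 / l - x1 - x2)) = - 2 * m * (y1 - m * x1)"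
        by algebra
      then show ?thesis
        using ec_third_gens[OF on, of m] m 1 unfolding P1 Q1 by (simp add: m_def del: gens.simps)
    next
      case 2
      then have "gens P * gens Q \<sim> 1"
        using gens_times_opposite[OF P] by (simp add: P1 Q1 del: gens.simps)
      then show ?thesis
        using 2 equiv_sym by (simp add: P1 Q1 del: gens.simps(2) set_one)
    next
      case 3
      have "(y1 - y2) * (y1 + y2) = 0"
        using on 3(1) by algebra
      with 3(2) have y: "y2 = y1" by (simp add: eq_neg_iff_add_eq_0)
      then have y1: "y1 \<noteq> 0" using 3 by auto
      define m where "m = 3 * l * x1 ^ 2 / (2 * y1)"
      have m: "2 * y1 * m = 3 * l * x1 ^ 2" using y1 two by (simp add: m_def)
      have "l * (m\<^sup>2 / l) = m\<^sup>2" using l0 by simp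
      then have "l * (x1 * x1 + (x1 + x1) * (m\<^sup>2 / l - x1 - x1)) = - 2 * m * (y1 - m * x1)"
        using m by algebra
      then show ?thesis
        using ec_third_gens[OF on(1) on(1), of m] 3 y y1 unfolding P1 Q1
        by (simp add: m_def del: gens.simps)
    qed
  qed
qed

lemma ec_add_closed: "P \<in> ec_points l k \<Longrightarrow> Q \<in> ec_points l k \<Longrightarrow> ec_add l P Q \<in> ec_points l k"
  and gens_ec_add: "P \<in> ec_points l k \<Longrightarrow> Q \<in> ec_points l k \<Longrightarrow>
    gens (ec_add l P Q) \<sim> gens P * gens Q"
  using ec_add_gens by simp_all

lemma ec_add_commute:
  assumes P: "P \<in> ec_points l k" and Q: "Q \<in> ec_points l k"
  shows "ec_add l P Q = ec_add l Q P"
proof (rule gens_inj)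
  have "gens (ec_add l P Q) \<sim> gens P * gens Q"
    by (rule gens_ec_add[OF P Q])
  also have "gens P * gens Q = gens Q * gens P"
    by (rule mult.commute)
  also have "\<dots> \<sim> gens (ec_add l Q P)"
    by (rule equiv_sym[OF gens_ec_add[OF Q P]])
  finally show "gens (ec_add l P Q) \<sim> gens (ec_add l Q P)" .
qed (rule ec_add_closed P Q)+

lemma ec_add_assoc:
  assumes P: "P \<in> ec_points l k" and Q: "Q \<in> ec_points l k" and R: "R \<in> ec_points l k"
  shows "ec_add l (ec_add l P Q) R = ec_add l P (ec_add l Q R)"
proof (rule gens_inj)
  have "gens (ec_add l (ec_add l P Q) R) \<sim> gens (ec_add l P Q) * gens R"
    by (rule gens_ec_add[OF ec_add_closed[OF P Q] R])
  also have "\<dots> \<sim> (gens P * gens Q) * gens R"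
    by (rule equiv_times[OF gens_ec_add[OF P Q]])
  also have "(gens P * gens Q) * gens R = (gens Q * gens R) * gens P"
    by (simp only: mult_ac)
  also have "\<dots> \<sim> gens (ec_add l Q R) * gens P"
    by (rule equiv_times[OF equiv_sym[OF gens_ec_add[OF Q R]]])
  also have "\<dots> = gens P * gens (ec_add l Q R)"
    by (rule mult.commute)
  also have "\<dots> \<sim> gens (ec_add l P (ec_add l Q R))"
    by (rule equiv_sym[OF gens_ec_add[OF P ec_add_closed[OF Q R]]])
  finally show "gens (ec_add l (ec_add l P Q) R) \<sim> gens (ec_add l P (ec_add l Q R))" .
qed (rule ec_add_closed P Q R)+

lemma ec_add_opposite: "ec_add l (opposite P) P = Infinity"
  by (cases P) auto

lemma ec_add_Infinity_right: "ec_add l P Infinity = P"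
  by (cases P) auto

theorem ec_group_comm_group: "comm_group (ec_group l k)"
proof (rule comm_groupI)
  fix P assume "P \<in> carrier (ec_group l k)"
  then show "\<exists>Q\<in>carrier (ec_group l k). Q \<otimes>\<^bsub>ec_group l k\<^esub> P = \<one>\<^bsub>ec_group l k\<^esub>"
    using ec_add_opposite opposite_closed by (auto simp: ec_group_def)
qed (auto simp: ec_group_def intro: ec_add_closed ec_add_assoc ec_add_commute)

end

section \<open>Independence by infinite descent\<close>

text \<open>
  Infinite descent. Splitting every exponent as \<open>2 m + e\<close> with \<open>e \<in> {0, 1}\<close> exhibits the product
  over the points with odd exponent as a square, so all exponents are even. In the absence of
  2-torsion the halved exponents form a smaller relation.
\<close>
lemma (in comm_group) int_independentI:
  assumes fin: "finite S" and S: "S \<subseteq> carrier G"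
    and torsion: "\<And>x. x \<in> carrier G \<Longrightarrow> x \<otimes> x = \<one> \<Longrightarrow> x = \<one>"
    and nonsquare: "\<And>T q. T \<subseteq> S \<Longrightarrow> T \<noteq> {} \<Longrightarrow> q \<in> carrier G \<Longrightarrow> (\<Otimes>P\<in>T. P) \<noteq> q \<otimes> q"
  shows "int_independent G S"
proof -
  have "\<forall>P\<in>S. n P = 0" if "(\<Otimes>P\<in>S. P [^] n P) = \<one>" for n :: "'a \<Rightarrow> int"
    using that
  proof (induction "\<Sum>P\<in>S. nat \<bar>n P\<bar>" arbitrary: n rule: less_induct)
    case less
    define m where "m P = n P div 2" for P
    define T where "T = {P \<in> S. odd (n P)}"
    define M where "M = (\<Otimes>P\<in>S. P [^] m P)"
    have M: "M \<in> carrier G" and T: "(\<Otimes>P\<in>T. P) \<in> carrier G"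
      unfolding M_def T_def using S by (auto intro!: finprod_closed)
    have split: "P [^] n P = (P [^] m P \<otimes> P [^] m P) \<otimes> (if P \<in> T then P else \<one>)" if "P \<in> S" for P
    proof -
      have P: "P \<in> carrier G" using that S by blast
      have "n P = m P + m P + (if P \<in> T then 1 else 0)"
        using that by (auto simp: m_def T_def elim!: evenE oddE)
      moreover have "P [^] (2 * m P) = P [^] m P \<otimes> P [^] m P"
        using int_pow_mult[OF P, of "m P" "m P"] by simp
      ultimately show ?thesis
        using P by (auto simp: int_pow_mult)
    qed
    have "(\<Otimes>P\<in>S. P [^] n P) = (\<Otimes>P\<in>S. (P [^] m P \<otimes> P [^] m P) \<otimes> (if P \<in> T then P else \<one>))"
      using S by (intro finprod_cong') (auto simp: split)
    also have "\<dots> = (M \<otimes> M) \<otimes> (\<Otimes>P\<in>S. if P \<in> T then P else \<one>)"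
      unfolding M_def using S by (subst finprod_multf; (subst finprod_multf)?; auto)
    also have "(\<Otimes>P\<in>S. if P \<in> T then P else \<one>) = (\<Otimes>P\<in>T. P)"
      using S fin by (intro finprod_mono_neutral_cong_right) (auto simp: T_def)
    finally have MT: "M \<otimes> M \<otimes> (\<Otimes>P\<in>T. P) = \<one>"
      using less.prems by simp
    then have "(\<Otimes>P\<in>T. P) \<otimes> (M \<otimes> M) = \<one>"
      using M T by (simp add: m_comm)
    then have "(\<Otimes>P\<in>T. P) = inv (M \<otimes> M)"
      by (rule inv_equality[symmetric]) (use M T in simp_all)
    also have "\<dots> = inv M \<otimes> inv M"
      using M by (simp add: inv_mult)
    finally have "T = {}"
      using nonsquare[of T "inv M"] M by (auto simp: T_def)
    with MT M have "M \<otimes> M = \<one>"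
      by simp
    with M have M1: "M = \<one>"
      by (rule torsion)
    show ?case
    proof (rule ccontr)
      assume "\<not> ?case"
      then obtain P0 where P0: "P0 \<in> S" "n P0 \<noteq> 0" by blast
      have n: "n P = 2 * m P" if "P \<in> S" for P
        using that \<open>T = {}\<close> by (auto simp: m_def T_def)
      have "(\<Sum>P\<in>S. nat \<bar>m P\<bar>) < (\<Sum>P\<in>S. nat \<bar>n P\<bar>)"
      proof (rule sum_strict_mono_ex1[OF fin])
        show "\<forall>P\<in>S. nat \<bar>m P\<bar> \<le> nat \<bar>n P\<bar>" using n by auto
        show "\<exists>P\<in>S. nat \<bar>m P\<bar> < nat \<bar>n P\<bar>" using n[OF P0(1)] P0 by (intro bexI[of _ P0]) auto
      qed
      then have "\<forall>P\<in>S. m P = 0"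
        using M1 unfolding M_def by (rule less.hyps)
      then show False using n P0 by auto
    qed
  qed
  then show ?thesis
    unfolding int_independent_def using fin S by blast
qed

section \<open>Specialization of fractions\<close>

lemma to_fract_power: "to_fract (a ^ n) = to_fract a ^ n"
  by (induction n) simp_all

text \<open>
  A ring homomorphism to a field extends to the fractions whose denominator it does not kill.
  The extension is kept as a relation \<open>spec x r\<close>; it is compatible with all field operations that
  make sense in the target.
\<close>
locale specialization =
  fixes ev :: "'r :: {factorial_ring_gcd, semiring_gcd_mult_normalize} \<Rightarrow> 'b :: field"
  assumes ev_add: "ev (a + b) = ev a + ev b"
    and ev_mult: "ev (a * b) = ev a * ev b"
    and ev_1: "ev 1 = 1"
begin

lemma ev_0: "ev 0 = 0"
  using ev_add[of 0 0] by (metis add.right_neutral add_left_imp_eq)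

lemma ev_uminus: "ev (- a) = - ev a"
  using ev_add[of a "- a"] by (simp add: ev_0 eq_neg_iff_add_eq_0 add.commute)

definition spec :: "'r fract \<Rightarrow> 'b \<Rightarrow> bool" where
  "spec x r \<longleftrightarrow> (\<exists>a b. ev b \<noteq> 0 \<and> x = to_fract a / to_fract b \<and> r = ev a / ev b)"

lemma specI: "ev b \<noteq> 0 \<Longrightarrow> spec (to_fract a / to_fract b) (ev a / ev b)"
  unfolding spec_def by blast

lemma specE:
  assumes "spec x r"
  obtains a b where "ev b \<noteq> 0" "b \<noteq> 0" "x = to_fract a / to_fract b" "r = ev a / ev b"
  using assms unfolding spec_def by (metis ev_0)

lemma spec_to_fract: "spec (to_fract a) (ev a)"
  using specI[of 1 a] by (simp add: ev_1)

lemma spec_add: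
  assumes "spec x r" "spec y s" shows "spec (x + y) (r + s)"
proof -
  obtain a b where 1: "ev b \<noteq> 0" "b \<noteq> 0" "x = to_fract a / to_fract b" "r = ev a / ev b"
    using assms(1) by (rule specE)
  obtain c d where 2: "ev d \<noteq> 0" "d \<noteq> 0" "y = to_fract c / to_fract d" "s = ev c / ev d"
    using assms(2) by (rule specE)
  have "x + y = to_fract (a * d + c * b) / to_fract (b * d)"
    unfolding 1 2 using 1(2) 2(2) by (simp add: add_frac_eq)
  moreover have "r + s = ev (a * d + c * b) / ev (b * d)"
    unfolding 1 2 using 1(1) 2(1) by (simp add: ev_add ev_mult add_frac_eq)
  ultimately show ?thesis
    by (simp only:) (rule specI, simp add: ev_mult 1 2)
qed

lemma spec_mult:
  assumes "spec x r" "spec y s" shows "spec (x * y) (r * s)"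
proof -
  obtain a b where 1: "ev b \<noteq> 0" "x = to_fract a / to_fract b" "r = ev a / ev b"
    using assms(1) by (rule specE)
  obtain c d where 2: "ev d \<noteq> 0" "y = to_fract c / to_fract d" "s = ev c / ev d"
    using assms(2) by (rule specE)
  show ?thesis using specI[of "b * d" "a * c"] 1(1) 2(1) by (simp add: 1 2 ev_mult)
qed

lemma spec_uminus:
  assumes "spec x r" shows "spec (- x) (- r)"
proof -
  obtain a b where 1: "ev b \<noteq> 0" "x = to_fract a / to_fract b" "r = ev a / ev b"
    using assms(1) by (rule specE)
  show ?thesis using specI[of b "- a"] 1(1) by (simp add: 1 ev_uminus)
qed

lemma spec_diff: "spec x r \<Longrightarrow> spec y s \<Longrightarrow> spec (x - y) (r - s)"
  using spec_add[of x r "- y" "- s"] spec_uminus by simp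

lemma spec_inverse:
  assumes "spec x r" "r \<noteq> 0" shows "spec (inverse x) (inverse r)"
proof -
  obtain a b where 1: "ev b \<noteq> 0" "x = to_fract a / to_fract b" "r = ev a / ev b"
    using assms(1) by (rule specE)
  show ?thesis using specI[of a b] 1(1) assms(2) by (simp add: 1)
qed

lemma spec_divide: "spec x r \<Longrightarrow> spec y s \<Longrightarrow> s \<noteq> 0 \<Longrightarrow> spec (x / y) (r / s)"
  unfolding divide_inverse by (intro spec_mult spec_inverse)

lemma spec_0: "spec 0 0" and spec_1: "spec 1 1"
  using spec_to_fract[of 0] spec_to_fract[of 1] by (simp_all add: ev_0 ev_1)

lemma spec_numeral: "spec (numeral n) (numeral n)"
proof -
  have "spec (of_nat m) (of_nat m)" for m
    by (induction m) (simp_all add: spec_0 spec_1 spec_add)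
  from this[of "numeral n"] show ?thesis by simp
qed

lemma spec_power: "spec x r \<Longrightarrow> spec (x ^ n) (r ^ n)"
  by (induction n) (simp_all add: spec_1 spec_mult)

lemmas spec_intros = spec_add spec_mult spec_uminus spec_diff spec_divide spec_power
  spec_numeral spec_0 spec_1

lemma spec_unique:
  assumes "spec x r" "spec x s" shows "r = s"
proof -
  have "spec 0 (r - s)" using spec_diff[OF assms] by simp
  then obtain a b where "b \<noteq> 0" "0 = to_fract a / to_fract b" "r - s = ev a / ev b"
    by (rule specE)
  then show ?thesis by (auto simp: ev_0)
qed

lemma spec_nonzero: "spec x r \<Longrightarrow> r \<noteq> 0 \<Longrightarrow> x \<noteq> 0"
  using spec_unique spec_0 by blast

lemma spec_common_denominator:
  assumes "finite I" "\<And>i. i \<in> I \<Longrightarrow> spec (c i) (d i)"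
  shows "\<exists>s e. ev s \<noteq> 0 \<and> (\<forall>i\<in>I. to_fract s * c i = to_fract (e i) \<and> ev s * d i = ev (e i))"
  using assms
proof (induction I rule: finite_induct)
  case empty
  show ?case by (intro exI[of _ 1]) (simp add: ev_1)
next
  case (insert j I)
  then obtain s e where s: "ev s \<noteq> 0"
    "\<And>i. i \<in> I \<Longrightarrow> to_fract s * c i = to_fract (e i) \<and> ev s * d i = ev (e i)"
    by (metis insertCI)
  have "spec (c j) (d j)" using insert by simp
  then obtain a b where ab: "ev b \<noteq> 0" "b \<noteq> 0" "c j = to_fract a / to_fract b" "d j = ev a / ev b"
    by (rule specE)
  define e' where "e' i = (if i = j then s * a else b * e i)" for i
  have "to_fract (s * b) * c i = to_fract (e' i) \<and> ev (s * b) * d i = ev (e' i)"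
    if "i \<in> insert j I" for i
  proof (cases "i = j")
    case True
    then show ?thesis using ab by (simp add: e'_def ev_mult)
  next
    case False
    then have *: "to_fract s * c i = to_fract (e i)" "ev s * d i = ev (e i)"
      using that s(2) by auto
    have "to_fract (s * b) * c i = to_fract b * (to_fract s * c i)"
      "ev (s * b) * d i = ev b * (ev s * d i)"
      by (simp_all only: to_fract_mult ev_mult mult_ac)
    then show ?thesis using False unfolding * by (simp add: e'_def ev_mult)
  qed
  moreover have "ev (s * b) \<noteq> 0"
    using s(1) ab(1) by (simp add: ev_mult)
  ultimately show ?case by blast
qed

text \<open>
  The local ring of specializable fractions is integrally closed because the base ring is
  factorial: for a root in lowest terms, the denominator divides the cleared leading coefficient,
  whose image is nonzero.
\<close>
lemma spec_root:
  assumes root: "(\<Sum>i\<le>n. c i * x ^ i) = 0"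
    and spec: "\<And>i. i \<le> n \<Longrightarrow> spec (c i) (d i)" and lead: "d n \<noteq> 0"
  shows "\<exists>r. spec x r"
proof -
  obtain s e where s: "ev s \<noteq> 0"
    and e: "\<And>i. i \<le> n \<Longrightarrow> to_fract s * c i = to_fract (e i)" "\<And>i. i \<le> n \<Longrightarrow> ev s * d i = ev (e i)"
    using spec_common_denominator[of "{..n}" c d] spec by (auto simp: Ball_def)
  define a b where "a = fst (quot_of_fract x)" and "b = snd (quot_of_fract x)"
  have b0: "b \<noteq> 0" and cop: "coprime a b" and x: "x = to_fract a / to_fract b"
    unfolding a_def b_def
    by (simp_all add: coprime_quot_of_fract Fract_conv_to_fract[symmetric])
  have "to_fract (\<Sum>i\<le>n. e i * a ^ i * b ^ (n - i)) = to_fract s * to_fract b ^ n * (\<Sum>i\<le>n. c i * x ^ i)"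
    unfolding to_fract_sum sum_distrib_left
  proof (rule sum.cong)
    fix i assume "i \<in> {..n}"
    then have i: "i \<le> n" by simp
    then have "to_fract b ^ n = to_fract b ^ (n - i) * to_fract b ^ i"
      by (simp flip: power_add)
    then show "to_fract (e i * a ^ i * b ^ (n - i)) = to_fract s * to_fract b ^ n * (c i * x ^ i)"
      using e(1)[OF i] b0 by (simp add: x to_fract_power power_divide)
  qed simp
  then have "(\<Sum>i\<le>n. e i * a ^ i * b ^ (n - i)) = 0"
    unfolding root by (simp only: mult_zero_right to_fract_eq_0_iff)
  moreover have "(\<Sum>i\<le>n. e i * a ^ i * b ^ (n - i)) = (\<Sum>i<n. e i * a ^ i * b ^ (n - i)) + e n * a ^ n"
    by (simp add: lessThan_Suc_atMost[symmetric])
  ultimately have "b dvd (\<Sum>i<n. e i * a ^ i * b ^ (n - i)) + e n * a ^ n"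
    by simp
  moreover have "b dvd (\<Sum>i<n. e i * a ^ i * b ^ (n - i))"
  proof (rule dvd_sum)
    fix i assume "i \<in> {..<n}"
    then have "b dvd b ^ (n - i)" by (intro dvd_power) simp
    then show "b dvd e i * a ^ i * b ^ (n - i)" by (rule dvd_mult)
  qed
  ultimately have "b dvd e n * a ^ n"
    by (simp only: dvd_add_right_iff)
  then have "b dvd e n"
    using cop by (simp add: coprime_commute coprime_dvd_mult_left_iff)
  moreover have "ev (e n) \<noteq> 0" using e(2)[of n] s lead by auto
  ultimately have "ev b \<noteq> 0" by (auto simp: ev_mult)
  then show ?thesis unfolding x using specI by blast
qed

section \<open>Specialization of points\<close>

text \<open>
  Affine points are related only to affine points: a point that reduces to the point at
  infinity has no specialization in this sense.
\<close>
fun spec_pt :: "'r fract ec_point \<Rightarrow> 'b ec_point \<Rightarrow> bool" where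
  "spec_pt (Affine x y) (Affine a b) \<longleftrightarrow> spec x a \<and> spec y b"
| "spec_pt P P' \<longleftrightarrow> P = Infinity \<and> P' = Infinity"

lemma spec_pt_Affine: "spec_pt P (Affine a b) \<longleftrightarrow> (\<exists>x y. P = Affine x y \<and> spec x a \<and> spec y b)"
  by (cases P) auto

text \<open>
  Distinct abscissas in the fibre force distinct abscissas upstairs, so both sums are chord sums.
\<close>
lemma spec_pt_add:
  assumes l: "spec l l'" "l' \<noteq> 0"
    and "spec_pt P (Affine a b)" "spec_pt Q (Affine c d)" "a \<noteq> c"
  shows "spec_pt (ec_add l P Q) (ec_third l' ((d - b) / (c - a)) a b c)"
proof -
  obtain x1 y1 where P: "P = Affine x1 y1" "spec x1 a" "spec y1 b"
    using assms(3) by (auto simp: spec_pt_Affine)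
  obtain x2 y2 where Q: "Q = Affine x2 y2" "spec x2 c" "spec y2 d"
    using assms(4) by (auto simp: spec_pt_Affine)
  have "x1 \<noteq> x2" using P(2) Q(2) assms(5) spec_unique by blast
  moreover have ca: "c - a \<noteq> 0" using assms(5) by simp
  have "spec ((y2 - y1) / (x2 - x1)) ((d - b) / (c - a))"
    by (intro spec_intros P Q ca)
  then have "spec_pt (ec_third l ((y2 - y1) / (x2 - x1)) x1 y1 x2) (ec_third l' ((d - b) / (c - a)) a b c)"
    unfolding ec_third_def Let_def spec_pt.simps by (intro conjI spec_intros P Q l ca)
  ultimately show ?thesis unfolding P(1) Q(1) by simp
qed

lemma no_two_torsion:
  assumes l: "spec l l'" "l' \<noteq> 0" and k: "spec k k'" and two: "(2::'b) \<noteq> 0"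
    and noroot: "\<And>r. l' * r ^ 3 + k' \<noteq> 0"
    and Q: "Q \<in> ec_points l k" "ec_add l Q Q = Infinity"
  shows "Q = Infinity"
proof (cases Q)
  case (Affine x y)
  have "(2::'r fract) \<noteq> 0" using spec_nonzero[OF spec_numeral two] .
  then have "y = 0"
    using Q(2) unfolding Affine by (auto simp: ec_third_def Let_def eq_neg_iff_add_eq_0 mult_2[symmetric] split: if_splits)
  then have root: "l * x ^ 3 + k = 0"
    using Q(1) unfolding Affine by (auto simp: ec_points_def affine_curve_def)
  define c where "c = (\<lambda>i. [k, 0, 0, l] ! i)"
  define d where "d = (\<lambda>i. [k', 0, 0, l'] ! i)"
  have "\<exists>r. spec x r"
  proof (rule spec_root[where n = 3 and c = c and d = d])
    have "(\<Sum>i\<le>3. c i * x ^ i) = k + l * x ^ 3"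
      by (simp add: c_def eval_nat_numeral)
    then show "(\<Sum>i\<le>3. c i * x ^ i) = 0"
      using root by (simp only: add.commute)
    show "spec (c i) (d i)" if "i \<le> 3" for i
    proof -
      have "i = 0 \<or> i = 1 \<or> i = 2 \<or> i = 3" using that by linarith
      then show ?thesis using l(1) k spec_0 by (auto simp: c_def d_def)
    qed
    show "d 3 \<noteq> 0" using l(2) by (simp add: d_def)
  qed
  then obtain r where "spec x r" ..
  then have "spec (l * x ^ 3 + k) (l' * r ^ 3 + k')"
    using l k by (intro spec_intros)
  then show ?thesis using root noroot spec_nonzero by metis
qed

text \<open>
  The abscissa \<open>x\<close> of a half \<open>Q\<close> of \<open>R\<close> is a root of the quartic obtained from the duplication formula
  by clearing the denominator \<open>4 y\<^sup>2 = 4 (l x\<^sup>3 + k)\<close>. Its leading coefficient \<open>l\<close> survives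
  specialization, so \<open>spec_root\<close> applies.
\<close>
lemma not_double:
  assumes l: "spec l l'" "l' \<noteq> 0" and k: "spec k k'" and two: "(2::'b) \<noteq> 0"
    and noroot: "\<And>r. l' * r ^ 4 - 4 * l' * X * r ^ 3 - 8 * k' * r - 4 * k' * X \<noteq> 0"
    and R: "spec_pt R (Affine X Y)" and Q: "Q \<in> ec_points l k"
  shows "R \<noteq> ec_add l Q Q"
proof
  assume RQ: "R = ec_add l Q Q"
  obtain x0 y0 where R: "R = Affine x0 y0" "spec x0 X"
    using R by (auto simp: spec_pt_Affine)
  then obtain x y where Qxy: "Q = Affine x y"
    using RQ by (cases Q) auto
  have y: "y ^ 2 = l * x ^ 3 + k"
    using Q unfolding Qxy by (auto simp: ec_points_def affine_curve_def)
  have two: "(2::'r fract) \<noteq> 0" using spec_nonzero[OF spec_numeral two] .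
  have l0: "l \<noteq> 0" by (rule spec_nonzero[OF l])
  have "y \<noteq> - y" using RQ R(1) unfolding Qxy by auto
  then have y0: "y \<noteq> 0" by auto
  define m where "m = 3 * l * x ^ 2 / (2 * y)"
  have "x0 = m\<^sup>2 / l - x - x"
    using RQ \<open>y \<noteq> - y\<close> unfolding R Qxy by (simp add: ec_third_def Let_def m_def)
  moreover have "l * (m\<^sup>2 / l) = m\<^sup>2" using l0 by simp
  ultimately have "l * x0 = m\<^sup>2 - 2 * l * x" by algebra
  moreover have "2 * y * m = 3 * l * x ^ 2" using y0 two by (simp add: m_def)
  ultimately have "4 * y\<^sup>2 * (l * x0) = 9 * l\<^sup>2 * x ^ 4 - 8 * l * x * y\<^sup>2"
    by algebra
  then have "4 * (l * x ^ 3 + k) * (l * x0) = 9 * l\<^sup>2 * x ^ 4 - 8 * l * x * (l * x ^ 3 + k)"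
    unfolding y .
  then have "l * (l * x ^ 4 - 4 * l * x0 * x ^ 3 - 8 * k * x - 4 * k * x0) = 0"
    by algebra
  then have root: "l * x ^ 4 - 4 * l * x0 * x ^ 3 - 8 * k * x - 4 * k * x0 = 0"
    using l0 by simp
  define c where "c = (\<lambda>i. [- 4 * k * x0, - 8 * k, 0, - 4 * l * x0, l] ! i)"
  define d where "d = (\<lambda>i. [- 4 * k' * X, - 8 * k', 0, - 4 * l' * X, l'] ! i)"
  have "\<exists>r. spec x r"
  proof (rule spec_root[where n = 4 and c = c and d = d])
    have "(\<Sum>i\<le>4. c i * x ^ i) = - 4 * k * x0 + - 8 * k * x + - 4 * l * x0 * x ^ 3 + l * x ^ 4"
      by (simp add: c_def eval_nat_numeral)
    then show "(\<Sum>i\<le>4. c i * x ^ i) = 0"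
      using root by algebra
    have "spec (- 4 * k * x0) (- 4 * k' * X)" "spec (- 8 * k) (- 8 * k')"
      "spec (- 4 * l * x0) (- 4 * l' * X)"
      using l k R by (intro spec_intros; simp)+
    moreover have "i = 0 \<or> i = 1 \<or> i = 2 \<or> i = 3 \<or> i = 4" if "i \<le> 4" for i :: nat
      using that by linarith
    ultimately show "spec (c i) (d i)" if "i \<le> 4" for i
      using that l(1) spec_0 by (fastforce simp: c_def d_def)
    show "d 4 \<noteq> 0" using l(2) by (simp add: d_def)
  qed
  then obtain r where "spec x r" ..
  then have "spec (l * x ^ 4 - 4 * l * x0 * x ^ 3 - 8 * k * x - 4 * k * x0)
      (l' * r ^ 4 - 4 * l' * X * r ^ 3 - 8 * k' * r - 4 * k' * X)"
    using l k R by (intro spec_intros)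
  then show False using root noroot spec_nonzero by metis
qed

lemma spec_fam:
  assumes sp: "spec \<alpha> a" "spec \<beta> b" "spec lam c" and two: "(2::'b) \<noteq> 0"
    and h: "fam_h a b c \<noteq> 0" "fam_h a b c \<noteq> fam_g a b c"
  shows "spec (fam_h \<alpha> \<beta> lam) (fam_h a b c)"
    and "spec (fam_g \<alpha> \<beta> lam) (fam_g a b c)"
    and "spec (fam_t \<alpha> \<beta> lam) (fam_t a b c)"
    and "spec (fam_l \<alpha> \<beta> lam) (fam_l a b c)"
    and "spec (fam_k \<alpha> \<beta> lam) (fam_k a b c)"
proof -
  show h': "spec (fam_h \<alpha> \<beta> lam) (fam_h a b c)" and g': "spec (fam_g \<alpha> \<beta> lam) (fam_g a b c)"
    unfolding fam_h_def fam_g_def by (intro spec_intros sp)+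
  have "2 * (fam_h a b c - fam_g a b c) \<noteq> 0" using two h by simp
  then show t': "spec (fam_t \<alpha> \<beta> lam) (fam_t a b c)"
    unfolding fam_t_def Let_def by (intro spec_intros sp h' g')
  show "spec (fam_l \<alpha> \<beta> lam) (fam_l a b c)" "spec (fam_k \<alpha> \<beta> lam) (fam_k a b c)"
    unfolding fam_l_def fam_k_def Let_def by (intro spec_intros sp h' t' h)+
qed

end

section \<open>Polynomials without rational roots\<close>

text \<open>
  With \<open>p\<close> prime to the leading coefficient, the denominator of a rational root is invertible
  modulo \<open>p\<close>, and the root reduces to a residue.
\<close>
lemma no_rational_root_mod:
  fixes f :: "int poly" and p :: int and x :: rat
  assumes p: "prime p" and lead: "\<not> p dvd lead_coeff f"
    and noroot: "list_all (\<lambda>r. \<not> p dvd poly f r) [0..p - 1]"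
  shows "poly (map_poly of_int f) x \<noteq> 0"
proof
  assume root: "poly (map_poly of_int f) x = 0"
  define N where "N = degree f"
  obtain m n where mn: "x = of_int m / of_int n" "n > 0" "coprime m n"
    by (metis quotient_of_div quotient_of_coprime quotient_of_denom_pos surj_pair)
  have "of_int (\<Sum>i\<le>N. coeff f i * m ^ i * n ^ (N - i)) = of_int n ^ N * (\<Sum>i\<le>N. of_int (coeff f i) * x ^ i)"
    unfolding of_int_sum sum_distrib_left
  proof (rule sum.cong)
    fix i assume "i \<in> {..N}"
    then have "(of_int n :: rat) ^ N = of_int n ^ (N - i) * of_int n ^ i"
      by (simp flip: power_add)
    then show "of_int (coeff f i * m ^ i * n ^ (N - i)) = (of_int n :: rat) ^ N * (of_int (coeff f i) * x ^ i)"
      using mn(2) by (simp add: mn(1) power_divide)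
  qed simp
  also have "(\<Sum>i\<le>N. of_int (coeff f i) * x ^ i) = poly (map_poly of_int f) x"
    by (simp add: poly_altdef N_def coeff_map_poly degree_map_poly)
  finally have hom: "(\<Sum>i\<le>N. coeff f i * m ^ i * n ^ (N - i)) = 0"
    unfolding root by (simp only: mult_zero_right of_int_eq_0_iff)
  have pn: "\<not> p dvd n"
  proof
    assume "p dvd n"
    have "p dvd (\<Sum>i<N. coeff f i * m ^ i * n ^ (N - i))"
    proof (rule dvd_sum)
      fix i assume "i \<in> {..<N}"
      then have "n dvd n ^ (N - i)" by (intro dvd_power) simp
      with \<open>p dvd n\<close> show "p dvd coeff f i * m ^ i * n ^ (N - i)"
        using dvd_mult dvd_trans by blast
    qed
    moreover have "(\<Sum>i\<le>N. coeff f i * m ^ i * n ^ (N - i))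
        = (\<Sum>i<N. coeff f i * m ^ i * n ^ (N - i)) + lead_coeff f * m ^ N"
      by (simp add: lessThan_Suc_atMost[symmetric] N_def)
    ultimately have "p dvd lead_coeff f * m ^ N"
      using hom by (metis dvd_0_right dvd_add_right_iff)
    then have "p dvd m"
      using p lead by (metis prime_dvd_mult_iff prime_dvd_power)
    with \<open>p dvd n\<close> mn(3) have "is_unit p" by (metis coprime_common_divisor)
    then show False using p not_prime_unit by blast
  qed
  then have "coprime n p"
    using p by (metis coprime_commute prime_imp_coprime)
  then obtain n' where n': "[n * n' = 1] (mod p)"
    using cong_solve_coprime_int by blast
  define r where "r = (m * n') mod p"
  have "[r * n = m * n' * n] (mod p)"
    unfolding r_def by (simp add: cong_def mod_mult_left_eq)
  also have "m * n' * n = m * (n * n')" by simp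
  also have "[m * (n * n') = m * 1] (mod p)" by (rule cong_scalar_left[OF n'])
  finally have rn: "[m = r * n] (mod p)" by (simp add: cong_sym)
  have "[(\<Sum>i\<le>N. coeff f i * m ^ i * n ^ (N - i)) = (\<Sum>i\<le>N. coeff f i * (r * n) ^ i * n ^ (N - i))] (mod p)"
    by (intro cong_sum cong_mult cong_pow cong_refl rn)
  also have "(\<Sum>i\<le>N. coeff f i * (r * n) ^ i * n ^ (N - i)) = n ^ N * poly f r"
    unfolding poly_altdef N_def[symmetric] sum_distrib_left
  proof (rule sum.cong)
    fix i assume "i \<in> {..N}"
    then have "n ^ N = n ^ i * n ^ (N - i)" by (simp flip: power_add)
    then show "coeff f i * (r * n) ^ i * n ^ (N - i) = n ^ N * (coeff f i * r ^ i)"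
      by (simp add: power_mult_distrib)
  qed simp
  finally have "p dvd n ^ N * poly f r"
    unfolding hom by (metis cong_0_iff cong_sym)
  then have "p dvd poly f r"
    using p pn by (metis prime_dvd_mult_iff prime_dvd_power)
  moreover have "r \<in> set [0..p - 1]"
    using prime_gt_0_int[OF p] by (simp add: r_def)
  ultimately show False using noroot unfolding list_all_iff by blast
qed

text \<open>
  The quartic of \<open>not_double\<close> for \<open>l = 27/77\<close>, \<open>k = 711/847\<close> and \<open>X = a / d\<close>, multiplied by
  \<open>847 d / 9\<close>, has the integer coefficients tested here.
\<close>
lemma duplication_no_root:
  fixes p a d :: int and r :: rat
  assumes p: "prime p" and d: "\<not> p dvd 33 * d"
    and noroot: "list_all (\<lambda>r. \<not> p dvd poly [:- 316 * a, - 632 * d, 0, - 132 * a, 33 * d:] r) [0..p - 1]"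
  shows "27 / 77 * r ^ 4 - 4 * (27 / 77) * (of_int a / of_int d) * r ^ 3
    - 8 * (711 / 847) * r - 4 * (711 / 847) * (of_int a / of_int d) \<noteq> 0"
proof
  assume *: "27 / 77 * r ^ 4 - 4 * (27 / 77) * (of_int a / of_int d) * r ^ 3
    - 8 * (711 / 847) * r - 4 * (711 / 847) * (of_int a / of_int d) = 0"
  have d0: "d \<noteq> 0" using d by auto
  define e :: rat where "e = of_int d"
  define X :: rat where "X = of_int a / e"
  have a: "of_int a = X * e" using d0 by (simp add: X_def e_def)
  let ?f = "[:- 316 * a, - 632 * d, 0, - 132 * a, 33 * d:]"
  have "poly (map_poly of_int ?f) r = - 316 * (X * e) - 632 * e * r - 132 * (X * e) * r ^ 3 + 33 * e * r ^ 4"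
    by (simp add: map_poly_pCons a flip: e_def) algebra
  also have "\<dots> = 847 / 9 * e * (27 / 77 * r ^ 4 - 4 * (27 / 77) * X * r ^ 3 - 8 * (711 / 847) * r - 4 * (711 / 847) * X)"
    by algebra
  also have "\<dots> = 0"
    using * by (simp only: X_def e_def mult_zero_right)
  finally have "poly (map_poly of_int ?f) r = 0" .
  moreover have "lead_coeff ?f = 33 * d" using d0 by simp
  ultimately show False using no_rational_root_mod[OF p, of ?f r] d noroot by simp
qed

section \<open>The family\<close>

text \<open>
  By the definition of \<open>k\<close> the point with abscissa \<open>v\<close> is on the curve. For the other points
  the claim, multiplied by \<open>h (h - g)\<close>, compares differences of squared ordinates with
  differences of cubed abscissas; it reduces to the identities
  \<open>(\<alpha> + \<beta>) h = \<beta> (v\<^sup>3 - u\<^sup>3)\<close>, \<open>g = v\<^sup>3 - z\<^sup>3\<close> and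
  \<open>\<beta> (v\<^sup>3 - w\<^sup>3) = \<beta> g - (\<beta> - \<alpha>) h\<close>.
\<close>
lemma fam_points_on_curve:
  fixes \<alpha> \<beta> lam :: "'a::field"
  assumes two: "(2::'a) \<noteq> 0" and h: "fam_h \<alpha> \<beta> lam \<noteq> 0" "fam_h \<alpha> \<beta> lam \<noteq> fam_g \<alpha> \<beta> lam"
  shows "set (fam_points \<alpha> \<beta> lam) \<subseteq> affine_curve (fam_l \<alpha> \<beta> lam) (fam_k \<alpha> \<beta> lam)"
proof -
  define g where "g = fam_g \<alpha> \<beta> lam"
  define h where "h = fam_h \<alpha> \<beta> lam"
  define t where "t = fam_t \<alpha> \<beta> lam"
  define l where "l = fam_l \<alpha> \<beta> lam"
  define k where "k = fam_k \<alpha> \<beta> lam"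
  have h0: "h \<noteq> 0" and hg: "h - g \<noteq> 0" using assms by (simp_all add: h_def g_def)
  have "2 * (h - g) \<noteq> 0" using two hg by simp
  moreover have "t = ((\<alpha> + \<beta>) * g - (\<beta> + 2 * \<alpha>) * h) / (2 * (h - g))"
    by (simp only: t_def fam_t_def Let_def h_def g_def)
  ultimately have t: "t * (2 * (h - g)) = (\<alpha> + \<beta>) * g - (\<beta> + 2 * \<alpha>) * h"
    by (metis nonzero_eq_divide_eq)
  have lh: "l * h = 2 * \<beta> * t + \<beta> * (\<alpha> + \<beta>)"
    using h0 by (simp add: l_def fam_l_def Let_def flip: h_def t_def)
  have "k * h = h * t ^ 2 + (2 * t + \<alpha> + \<beta>) * (h * (\<alpha> + \<beta>) - \<beta> * (\<beta> - \<alpha>) ^ 3)"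
    using h0 by (simp add: k_def fam_k_def Let_def flip: h_def t_def)
  also have "\<dots> = h * (t + \<alpha> + \<beta>)\<^sup>2 - (l * h) * (\<beta> - \<alpha>) ^ 3"
    unfolding lh by algebra
  finally have "h * k = h * ((t + \<alpha> + \<beta>)\<^sup>2 - l * (\<beta> - \<alpha>) ^ 3)"
    by algebra
  then have k: "k = (t + \<alpha> + \<beta>)\<^sup>2 - l * (\<beta> - \<alpha>) ^ 3"
    by (simp only: mult_left_cancel[OF h0])
  have on: "y\<^sup>2 = l * x ^ 3 + k"
    if "(h - g) * (h * ((t + \<alpha> + \<beta>)\<^sup>2 - y\<^sup>2) - l * h * ((\<beta> - \<alpha>) ^ 3 - x ^ 3)) = 0" for x y
  proof -
    have "(h - g) * (h * ((t + \<alpha> + \<beta>)\<^sup>2 - y\<^sup>2 - l * ((\<beta> - \<alpha>) ^ 3 - x ^ 3))) = 0"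
      using that by algebra
    then have "(t + \<alpha> + \<beta>)\<^sup>2 - y\<^sup>2 - l * ((\<beta> - \<alpha>) ^ 3 - x ^ 3) = 0"
      using h0 hg by (simp only: mult_eq_0_iff simp_thms)
    then show ?thesis unfolding k by algebra
  qed
  have hh: "h = 27 * \<beta> * (27 * (\<alpha> + \<beta>) ^ 2 * lam ^ 9 - 9 * (\<beta> ^ 2 - \<alpha> ^ 2) * lam ^ 6 + (\<beta> - \<alpha>) ^ 2 * lam ^ 3)"
    by (simp add: h_def fam_h_def)
  have gg: "g = 729 * (\<alpha> + \<beta>) ^ 3 * lam ^ 12 + (\<beta> - \<alpha>) ^ 3"
    by (simp add: g_def fam_g_def)
  have v: "(t + \<alpha> + \<beta>)\<^sup>2 = l * fam_v \<alpha> \<beta> lam ^ 3 + k"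
    by (rule on) (simp add: fam_v_def)
  have "(\<alpha> + \<beta>) * h = \<beta> * ((\<beta> - \<alpha>) ^ 3 - fam_u \<alpha> \<beta> lam ^ 3)"
    unfolding hh fam_u_def by algebra
  then have u: "t\<^sup>2 = l * fam_u \<alpha> \<beta> lam ^ 3 + k"
    by (intro on) (use lh in algebra)
  have "g = (\<beta> - \<alpha>) ^ 3 - fam_z \<alpha> \<beta> lam ^ 3"
    unfolding gg fam_z_def by algebra
  then have z: "(t + \<alpha>)\<^sup>2 = l * fam_z \<alpha> \<beta> lam ^ 3 + k"
    by (intro on) (use lh t in algebra)
  have "\<beta> * ((\<beta> - \<alpha>) ^ 3 - fam_w \<alpha> \<beta> lam ^ 3) = \<beta> * g - (\<beta> - \<alpha>) * h"
    unfolding gg hh fam_w_def by algebra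
  then have w: "(t + \<beta>)\<^sup>2 = l * fam_w \<alpha> \<beta> lam ^ 3 + k"
    by (intro on) (use lh t in algebra)
  show ?thesis
    using u v w z by (auto simp: fam_points_def affine_curve_def Let_def t_def l_def k_def)
qed

lemma fam_arith_prog:
  fixes d lam :: rat
  assumes "d \<noteq> 0"
  shows "\<exists>ys. mset ys = mset (map snd (fam_points (2 * d) (- d) lam)) \<and> arith_prog ys"
proof (intro exI conjI)
  let ?t = "fam_t (2 * d) (- d) lam"
  show "mset [?t - d, ?t, ?t + d, ?t + 2 * d] = mset (map snd (fam_points (2 * d) (- d) lam))"
    by (simp add: fam_points_def Let_def)
  show "arith_prog [?t - d, ?t, ?t + d, ?t + 2 * d]"
    unfolding arith_prog_def
    by (rule exI[of _ "?t - d"], rule exI[of _ d]) (use assms in \<open>simp add: upt_rec\<close>)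
qed

text \<open>
  The outermost polynomial variable is \<open>\<lambda>\<close>, the innermost one \<open>\<alpha>\<close>.
\<close>
definition eval3 :: "'a::field \<Rightarrow> 'a \<Rightarrow> 'a \<Rightarrow> 'a poly poly poly \<Rightarrow> 'a" where
  "eval3 a b c p = poly (poly (poly p [:[:c:]:]) [:b:]) a"

lemma eval3_specialization: "specialization (eval3 (a::rat) b c)"
  by standard (simp_all add: eval3_def)

text \<open>
  The fibre \<open>(1, 2, - 1/3)\<close> is chosen because its points have small coordinates, all chord sums below have
  distinct abscissas, and every subset sum is seen not to be a double modulo 5, 7 or 19.
\<close>
lemma generic_curve:
  shows "nonsingular_curve (fam_l gen_alpha gen_beta gen_lambda) (fam_k gen_alpha gen_beta gen_lambda)"
    and "mordell_weil_rank (fam_l gen_alpha gen_beta gen_lambda) (fam_k gen_alpha gen_beta gen_lambda) \<ge> 4"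
proof -
  interpret specialization "eval3 (1::rat) 2 (- (1 / 3))"
    by (rule eval3_specialization)
  let ?l = "fam_l gen_alpha gen_beta gen_lambda"
  let ?k = "fam_k gen_alpha gen_beta gen_lambda"
  let ?h = "fam_h gen_alpha gen_beta gen_lambda"
  let ?g = "fam_g gen_alpha gen_beta gen_lambda"
  let ?t = "fam_t gen_alpha gen_beta gen_lambda"
  have sgen: "spec gen_alpha 1" "spec gen_beta 2" "spec gen_lambda (- (1 / 3))"
    unfolding gen_alpha_def gen_beta_def gen_lambda_def
    using spec_to_fract[of "[:[:[:0, 1:]:]:]"] spec_to_fract[of "[:[:0, 1:]:]"] spec_to_fract[of "[:0, 1:]"]
    by (simp_all add: eval3_def)
  have h: "fam_h 1 2 (- (1 / 3) :: rat) = - 14 / 3"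
    by (simp add: fam_h_def power_divide)
  have g: "fam_g 1 2 (- (1 / 3) :: rat) = 28 / 27"
    by (simp add: fam_g_def power_divide)
  have t: "fam_t 1 2 (- (1 / 3) :: rat) = - 21 / 11"
    by (simp add: fam_t_def Let_def power2_eq_square h g)
  have l: "fam_l 1 2 (- (1 / 3) :: rat) = 27 / 77"
    by (simp add: fam_l_def Let_def power2_eq_square h t)
  have k: "fam_k 1 2 (- (1 / 3) :: rat) = 711 / 847"
    by (simp add: fam_k_def Let_def power2_eq_square h t)
  have hg: "fam_h 1 2 (- (1 / 3) :: rat) \<noteq> 0" "fam_h 1 2 (- (1 / 3) :: rat) \<noteq> fam_g 1 2 (- (1 / 3))"
    by (simp_all add: h g)
  have sl: "spec ?l (27 / 77)" and sk: "spec ?k (711 / 847)" and st: "spec ?t (- 21 / 11)"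
    and sh: "spec ?h (- 14 / 3)" and sg: "spec ?g (28 / 27)"
    using spec_fam[OF sgen _ hg] by (simp_all add: l k t g h)
  have two: "(2 :: ratfun3) \<noteq> 0" and three: "(3 :: ratfun3) \<noteq> 0"
    and l0: "?l \<noteq> 0" and k0: "?k \<noteq> 0" and h0: "?h \<noteq> 0"
    using spec_nonzero[OF spec_numeral] spec_nonzero[OF sl] spec_nonzero[OF sk] spec_nonzero[OF sh]
    by simp_all
  have hg': "?h \<noteq> ?g"
    using spec_nonzero[OF spec_diff[OF sh sg]] by simp
  show nonsing: "nonsingular_curve ?l ?k"
    using l0 k0 by (simp add: nonsingular_curve_def)
  interpret mordell_curve ?l ?k
    using two three nonsing by unfold_locales (simp_all add: nonsingular_curve_def)
  let ?G = "ec_group ?l ?k"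
  interpret E: comm_group ?G by (rule ec_group_comm_group)

  define P1 where "P1 = Affine (fam_z gen_alpha gen_beta gen_lambda) (?t + gen_alpha)"
  define P2 where "P2 = Affine (fam_w gen_alpha gen_beta gen_lambda) (?t + gen_beta)"
  define P3 where "P3 = Affine (fam_v gen_alpha gen_beta gen_lambda) (?t + gen_alpha + gen_beta)"
  define P4 where "P4 = Affine (fam_u gen_alpha gen_beta gen_lambda) ?t"
  have "set (fam_points gen_alpha gen_beta gen_lambda) \<subseteq> affine_curve ?l ?k"
    by (rule fam_points_on_curve[OF two h0 hg'])
  then have on: "P1 \<in> ec_points ?l ?k" "P2 \<in> ec_points ?l ?k" "P3 \<in> ec_points ?l ?k" "P4 \<in> ec_points ?l ?k"
    by (auto simp: fam_points_def Let_def affine_curve_def P1_def P2_def P3_def P4_def)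
  have "spec (fam_z gen_alpha gen_beta gen_lambda) (fam_z 1 2 (- (1 / 3)))"
    "spec (fam_w gen_alpha gen_beta gen_lambda) (fam_w 1 2 (- (1 / 3)))"
    "spec (fam_v gen_alpha gen_beta gen_lambda) (fam_v 1 2 (- (1 / 3)))"
    "spec (fam_u gen_alpha gen_beta gen_lambda) (fam_u 1 2 (- (1 / 3)))"
    unfolding fam_z_def fam_w_def fam_v_def fam_u_def by (intro spec_intros sgen)+
  then have s1: "spec_pt P1 (Affine (- 1 / 3) (- 10 / 11))"
    and s2: "spec_pt P2 (Affine (- 4 / 3) (1 / 11))"
    and s3: "spec_pt P3 (Affine 1 (12 / 11))"
    and s4: "spec_pt P4 (Affine 2 (- 21 / 11))"
    using spec_add[OF st sgen(1)] spec_add[OF st sgen(2)] spec_add[OF spec_add[OF st sgen(1)] sgen(2)] st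
    unfolding P1_def P2_def P3_def P4_def
    by (simp_all add: fam_z_def fam_w_def fam_v_def fam_u_def power_divide)
  have s12: "spec_pt (ec_add ?l P1 P2) (Affine (122 / 27) (1711 / 297))"
    using spec_pt_add[OF sl _ s1 s2] by (simp add: ec_third_def power_divide)
  have s13: "spec_pt (ec_add ?l P1 P3) (Affine (23 / 4) (- 723 / 88))"
    using spec_pt_add[OF sl _ s1 s3] by (simp add: ec_third_def power_divide)
  have s14: "spec_pt (ec_add ?l P1 P4) (Affine (- 8 / 7) (303 / 539))"
    using spec_pt_add[OF sl _ s1 s4] by (simp add: ec_third_def power_divide)
  have s23: "spec_pt (ec_add ?l P2 P3) (Affine (6 / 7) (- 555 / 539))"
    using spec_pt_add[OF sl _ s2 s3] by (simp add: ec_third_def power_divide)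
  have s24: "spec_pt (ec_add ?l P2 P4) (Affine (9 / 25) (1272 / 1375))"
    using spec_pt_add[OF sl _ s2 s4] by (simp add: ec_third_def power_divide)
  have s34: "spec_pt (ec_add ?l P3 P4) (Affine (68 / 3) (703 / 11))"
    using spec_pt_add[OF sl _ s3 s4] by (simp add: ec_third_def power_divide)
  have s123: "spec_pt (ec_add ?l P1 (ec_add ?l P2 P3)) (Affine (- 136 / 275) (13503 / 15125))"
    using spec_pt_add[OF sl _ s1 s23] by (simp add: ec_third_def power_divide)
  have s124: "spec_pt (ec_add ?l P1 (ec_add ?l P2 P4)) (Affine (877 / 44) (- 51015 / 968))"
    using spec_pt_add[OF sl _ s1 s24] by (simp add: ec_third_def power_divide)
  have s134: "spec_pt (ec_add ?l P1 (ec_add ?l P3 P4)) (Affine (94 / 297) (- 3013 / 3267))"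
    using spec_pt_add[OF sl _ s1 s34] by (simp add: ec_third_def power_divide)
  have s234: "spec_pt (ec_add ?l P2 (ec_add ?l P3 P4)) (Affine (- 617 / 528) (- 4097 / 7744))"
    using spec_pt_add[OF sl _ s2 s34] by (simp add: ec_third_def power_divide)
  have s1234: "spec_pt (ec_add ?l P1 (ec_add ?l P2 (ec_add ?l P3 P4))) (Affine (2153 / 1029) (372118 / 184877))"
    using spec_pt_add[OF sl _ s1 s234] by (simp add: ec_third_def power_divide)

  \<comment> \<open>The abscissa is passed as a fraction \<open>a / d\<close> together with a prime that excludes roots of its
    quartic.\<close>
  have nd: "R \<noteq> ec_add ?l Q Q"
    if "spec_pt R (Affine X Y)" "Q \<in> ec_points ?l ?k" "X = of_int a / of_int d"
      "prime p" "\<not> p dvd 33 * d"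
      "list_all (\<lambda>r. \<not> p dvd poly [:- 316 * a, - 632 * d, 0, - 132 * a, 33 * d:] r) [0..p - 1]"
    for R Q X Y a d and p :: int
    by (rule not_double[OF sl _ sk _ duplication_no_root[OF that(4-6)] that(1)[unfolded that(3)] that(2)]) simp_all
  have d1: "P1 \<noteq> ec_add ?l Q Q" if "Q \<in> ec_points ?l ?k" for Q
    by (rule nd[OF s1 that, where a = "(- 1)" and d = 3 and p = 5]) (simp_all add: upto_rec1)
  have d2: "P2 \<noteq> ec_add ?l Q Q" if "Q \<in> ec_points ?l ?k" for Q
    by (rule nd[OF s2 that, where a = "(- 4)" and d = 3 and p = 7]) (simp_all add: upto_rec1)
  have d3: "P3 \<noteq> ec_add ?l Q Q" if "Q \<in> ec_points ?l ?k" for Q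
    by (rule nd[OF s3 that, where a = "1" and d = 1 and p = 5]) (simp_all add: upto_rec1)
  have d4: "P4 \<noteq> ec_add ?l Q Q" if "Q \<in> ec_points ?l ?k" for Q
    by (rule nd[OF s4 that, where a = "2" and d = 1 and p = 7]) (simp_all add: upto_rec1)
  have d12: "ec_add ?l P1 P2 \<noteq> ec_add ?l Q Q" if "Q \<in> ec_points ?l ?k" for Q
    by (rule nd[OF s12 that, where a = "122" and d = 27 and p = 5]) (simp_all add: upto_rec1)
  have d13: "ec_add ?l P1 P3 \<noteq> ec_add ?l Q Q" if "Q \<in> ec_points ?l ?k" for Q
    by (rule nd[OF s13 that, where a = "23" and d = 4 and p = 7]) (simp_all add: upto_rec1)
  have d14: "ec_add ?l P1 P4 \<noteq> ec_add ?l Q Q" if "Q \<in> ec_points ?l ?k" for Q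
    by (rule nd[OF s14 that, where a = "(- 8)" and d = 7 and p = 5]) (simp_all add: upto_rec1)
  have d23: "ec_add ?l P2 P3 \<noteq> ec_add ?l Q Q" if "Q \<in> ec_points ?l ?k" for Q
    by (rule nd[OF s23 that, where a = "6" and d = 7 and p = 5]) (simp_all add: upto_rec1)
  have d24: "ec_add ?l P2 P4 \<noteq> ec_add ?l Q Q" if "Q \<in> ec_points ?l ?k" for Q
    by (rule nd[OF s24 that, where a = "9" and d = 25 and p = 7]) (simp_all add: upto_rec1)
  have d34: "ec_add ?l P3 P4 \<noteq> ec_add ?l Q Q" if "Q \<in> ec_points ?l ?k" for Q
    by (rule nd[OF s34 that, where a = "68" and d = 3 and p = 5]) (simp_all add: upto_rec1)
  have d123: "ec_add ?l P1 (ec_add ?l P2 P3) \<noteq> ec_add ?l Q Q" if "Q \<in> ec_points ?l ?k" for Q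
    by (rule nd[OF s123 that, where a = "(- 136)" and d = 275 and p = 7]) (simp_all add: upto_rec1)
  have d124: "ec_add ?l P1 (ec_add ?l P2 P4) \<noteq> ec_add ?l Q Q" if "Q \<in> ec_points ?l ?k" for Q
    by (rule nd[OF s124 that, where a = "877" and d = 44 and p = 5]) (simp_all add: upto_rec1)
  have d134: "ec_add ?l P1 (ec_add ?l P3 P4) \<noteq> ec_add ?l Q Q" if "Q \<in> ec_points ?l ?k" for Q
    by (rule nd[OF s134 that, where a = "94" and d = 297 and p = 7]) (simp_all add: upto_rec1)
  have d234: "ec_add ?l P2 (ec_add ?l P3 P4) \<noteq> ec_add ?l Q Q" if "Q \<in> ec_points ?l ?k" for Q
    by (rule nd[OF s234 that, where a = "(- 617)" and d = 528 and p = 5]) (simp_all add: upto_rec1)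
  have d1234: "ec_add ?l P1 (ec_add ?l P2 (ec_add ?l P3 P4)) \<noteq> ec_add ?l Q Q" if "Q \<in> ec_points ?l ?k" for Q
    by (rule nd[OF s1234 that, where a = "2153" and d = 1029 and p = 19]) (simp_all add: upto_rec1)

  have distinct: "P1 \<noteq> P2" "P1 \<noteq> P3" "P1 \<noteq> P4" "P2 \<noteq> P3" "P2 \<noteq> P4" "P3 \<noteq> P4"
    using s1 s2 s3 s4 by (auto simp: spec_pt_Affine dest: spec_unique)
  let ?S = "{P1, P2, P3, P4}"
  have S: "?S \<subseteq> carrier ?G" using on by (simp add: ec_group_def)
  have "int_independent ?G ?S"
  proof (rule E.int_independentI)
    fix Q assume "Q \<in> carrier ?G" "Q \<otimes>\<^bsub>?G\<^esub> Q = \<one>\<^bsub>?G\<^esub>"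
    moreover have "27 / 77 * r ^ 3 + 711 / 847 \<noteq> 0" for r :: rat
    proof
      assume *: "27 / 77 * r ^ 3 + 711 / 847 = 0"
      have "poly (map_poly of_int [:79, 0, 0, 33:]) r = 79 + 33 * r ^ 3"
        by (simp add: map_poly_pCons power3_eq_cube)
      also have "\<dots> = 847 / 9 * (27 / 77 * r ^ 3 + 711 / 847)"
        by algebra
      also have "\<dots> = 0" unfolding * by simp
      finally show False
        \<comment> \<open>13 is congruent to 1 modulo 3, so not every residue is a cube; \<open>-79/33\<close> is not one.\<close>
        using no_rational_root_mod[of 13 "[:79, 0, 0, 33:]" r] by (simp add: upto_rec1)
    qed
    ultimately show "Q = \<one>\<^bsub>?G\<^esub>"
      using no_two_torsion[OF sl _ sk] by (simp add: ec_group_def)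
  next
    fix T Q assume T: "T \<subseteq> ?S" "T \<noteq> {}" and Q: "Q \<in> carrier ?G"
    have "(\<Otimes>\<^bsub>?G\<^esub>P\<in>T. P) = (\<Otimes>\<^bsub>?G\<^esub>P\<in>?S. if P \<in> T then P else \<one>\<^bsub>?G\<^esub>)"
      using S T by (intro E.finprod_mono_neutral_cong_left) auto
    also have "\<dots> = (if P1 \<in> T then P1 else \<one>\<^bsub>?G\<^esub>) \<otimes>\<^bsub>?G\<^esub> ((if P2 \<in> T then P2 else \<one>\<^bsub>?G\<^esub>)
        \<otimes>\<^bsub>?G\<^esub> ((if P3 \<in> T then P3 else \<one>\<^bsub>?G\<^esub>) \<otimes>\<^bsub>?G\<^esub> (if P4 \<in> T then P4 else \<one>\<^bsub>?G\<^esub>)))"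
      using S distinct by (simp add: Pi_def)
    finally show "(\<Otimes>\<^bsub>?G\<^esub>P\<in>T. P) \<noteq> Q \<otimes>\<^bsub>?G\<^esub> Q"
      using T Q d1 d2 d3 d4 d12 d13 d14 d23 d24 d34 d123 d124 d134 d234 d1234
      by (cases "P1 \<in> T"; cases "P2 \<in> T"; cases "P3 \<in> T"; cases "P4 \<in> T")
        (auto simp: ec_group_def ec_add_Infinity_right)
  qed (use S in simp_all)
  moreover have "card ?S = 4" using distinct by simp
  ultimately have "enat 4 \<le> abelian_rank ?G"
    unfolding abelian_rank_def by (metis (mono_tags, lifting) SUP_upper mem_Collect_eq)
  then show "4 \<le> mordell_weil_rank ?l ?k"
    by (simp add: mordell_weil_rank_def numeral_eq_enat)
qed

theorem mainTheorem2:
  shows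
    "(\<forall>\<alpha> \<beta> lam :: rat.
        fam_h \<alpha> \<beta> lam \<noteq> 0 \<and> fam_h \<alpha> \<beta> lam \<noteq> fam_g \<alpha> \<beta> lam \<longrightarrow>
        set (fam_points \<alpha> \<beta> lam) \<subseteq> affine_curve (fam_l \<alpha> \<beta> lam) (fam_k \<alpha> \<beta> lam))
     \<and>
     (let l = fam_l gen_alpha gen_beta gen_lambda;
          k = fam_k gen_alpha gen_beta gen_lambda
      in nonsingular_curve l k \<and> mordell_weil_rank l k \<ge> 4)
     \<and>
     (\<forall>d lam :: rat. \<forall>\<alpha> \<beta>.
        d \<noteq> 0 \<and> \<alpha> = 2 * d \<and> \<beta> = - d \<and>
        fam_h \<alpha> \<beta> lam \<noteq> 0 \<and> fam_h \<alpha> \<beta> lam \<noteq> fam_g \<alpha> \<beta> lam \<longrightarrow>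
        (\<exists>ys. mset ys = mset (map snd (fam_points \<alpha> \<beta> lam)) \<and> arith_prog ys))"
proof (intro conjI)
  show "\<forall>\<alpha> \<beta> lam :: rat.
        fam_h \<alpha> \<beta> lam \<noteq> 0 \<and> fam_h \<alpha> \<beta> lam \<noteq> fam_g \<alpha> \<beta> lam \<longrightarrow>
        set (fam_points \<alpha> \<beta> lam) \<subseteq> affine_curve (fam_l \<alpha> \<beta> lam) (fam_k \<alpha> \<beta> lam)"
    using fam_points_on_curve[where 'a = rat] by simp
  show "let l = fam_l gen_alpha gen_beta gen_lambda; k = fam_k gen_alpha gen_beta gen_lambda
      in nonsingular_curve l k \<and> mordell_weil_rank l k \<ge> 4"
    unfolding Let_def using generic_curve by blast
  show "\<forall>d lam :: rat. \<forall>\<alpha> \<beta>.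
        d \<noteq> 0 \<and> \<alpha> = 2 * d \<and> \<beta> = - d \<and>
        fam_h \<alpha> \<beta> lam \<noteq> 0 \<and> fam_h \<alpha> \<beta> lam \<noteq> fam_g \<alpha> \<beta> lam \<longrightarrow>
        (\<exists>ys. mset ys = mset (map snd (fam_points \<alpha> \<beta> lam)) \<and> arith_prog ys)"
    using fam_arith_prog by blast
qed

end
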